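(* If $L_{\max}=+\infty$, then the continuous level Monte Carlo (CLMC) estimator $$\widehat{Q}^{\mathrm{CLMC}}_{\infty} = \frac{1}{N}\sum_{k=1}^{N}\int_0^{\infty}\frac{1}{\mathbb{P}(L\ge \ell)}\left(\frac{\mathrm{d}Q}{\mathrm{d}\ell}\right)^{(k)}(\ell)\,\mathbf{1}_{[0,L^{(k)}]}(\ell)\,\mathrm{d}\ell$$ satisfies $$\mathbb{E}\big[\widehat{Q}^{\mathrm{CLMC}}_{\infty}\big]=\mathbb{E}[\mathcal{Q}-Q(0)].$$
   Context: $\mathcal{Q}$ is a scalar random quantity of interest, and $(Q(\ell))_{\ell\ge 0}$ is a stochastic process of approximations of $\mathcal{Q}$, indexed by the continuous level of resolution $\ell$, with $Q(\ell)\to\mathcal{Q}$ almost surely as $\ell\to+\infty$. For a deterministic constant $L_{\max}\in[0,\infty]$, the CLMC estimator is in general the same expression with the integral taken over $(0,L_{\max})$, and it is assumed that $Q\in W^{1,1}(0,L_{\max})$ as a function of $\ell$; here $L_{\max}=+\infty$, so $Q\in W^{1,1}(0,\infty)$. The Sobolev space $W^{1,1}(0,L_{\max})$ contains the functions over $\ell\in(0,L_{\max})$ such that the functions and their weak first derivatives have finite $L^1$ norm; $\frac{\mathrm{d}Q}{\mathrm{d}\ell}$ denotes the derivative with respect to $\ell$. $L$ is a random variable with finite expectation (the random finest level of resolution), taking values in the levels $\ell\ge 0$, and independent of the whole stochastic process $(Q(\ell))_{\ell\ge 0}$; $\mathbb{P}(L\ge\ell)>0$ for all $\ell\ge 0$,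 so that the weight in the estimator is defined. The superscript $(k)$ denotes the $k$-th realisation (independent samples) of the respective random variable, $N$ is the total number of samples, and $\mathbf{1}_A$ is the indicator function of $A$.
   Formalization: The identity is proved whenever the estimator has a finite expectation, which is shown to hold if E∫|dQ/dℓ|dℓ is finite; sample paths of Q are taken to be the continuous representatives on [0,∞), so that Q(0) is meaningful. *)

theory Defs
  imports "HOL-Probability.Probability"
begin

definition test_function_on :: "real set \<Rightarrow> (real \<Rightarrow> real) \<Rightarrow> bool" where
  "test_function_on I \<phi> \<longleftrightarrow>
     (\<forall>n x. (deriv ^^ n) \<phi> differentiable (at x)) \<and>
     (\<exists>K. compact K \<and> K \<subseteq> I \<and> (\<forall>x. x \<notin> K \<longrightarrow> \<phi> x = 0))"

text \<open>The domain \<open>I\<close> is meant to be open. The derivative \<open>g\<close> is determined only almost everywhere.\<close>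

definition has_weak_derivative_on ::
    "(real \<Rightarrow> real) \<Rightarrow> (real \<Rightarrow> real) \<Rightarrow> real set \<Rightarrow> bool" where
  "has_weak_derivative_on f g I \<longleftrightarrow>
     (\<forall>K. compact K \<and> K \<subseteq> I \<longrightarrow> f absolutely_integrable_on K \<and> g absolutely_integrable_on K) \<and>
     (\<forall>\<phi>. test_function_on I \<phi> \<longrightarrow>
        (LINT x:I|lebesgue. f x * deriv \<phi> x) = - (LINT x:I|lebesgue. g x * \<phi> x))"

definition sobolev_W11 :: "real set \<Rightarrow> (real \<Rightarrow> real) set" where
  "sobolev_W11 I =
     {f. f absolutely_integrable_on I \<and>
         (\<exists>g. g absolutely_integrable_on I \<and> has_weak_derivative_on f g I)}"

text \<open>
  The random variables live on \<open>M\<close>. The sample points \<open>S k\<close>, defined on a second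
  probability space, are to be independent with law \<open>M\<close>, and the \<open>k\<close>-th realisation of a
  random variable \<open>X\<close> on \<open>M\<close> is \<open>X \<circ> S k\<close>; thus the realisations of \<open>dQ\<close> and of \<open>L\<close> with
  the same index are coupled as \<open>dQ\<close> and \<open>L\<close> are.
\<close>

definition clmc_estimator ::
    "'a measure \<Rightarrow> (real \<Rightarrow> 'a \<Rightarrow> real) \<Rightarrow> ('a \<Rightarrow> real) \<Rightarrow> nat \<Rightarrow> (nat \<Rightarrow> 'b \<Rightarrow> 'a) \<Rightarrow> 'b \<Rightarrow> real" where
  "clmc_estimator M dQ L N S \<eta> =
     (1 / real N) *
     (\<Sum>k=1..N. LINT l:{0<..}|lebesgue.
        1 / measure M {\<omega> \<in> space M. L \<omega> \<ge> l} * dQ l (S k \<eta>) * indicator {0..L (S k \<eta>)} l)"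

text \<open>
  Independence of a real random variable and a whole process. The constant \<open>indep_var\<close>
  requires both variables to take values in the same type, so the generated
  sigma-algebras are compared directly.
\<close>

definition indep_of_process :: "'a measure \<Rightarrow> ('a \<Rightarrow> real) \<Rightarrow> (real \<Rightarrow> 'a \<Rightarrow> real) \<Rightarrow> bool" where
  "indep_of_process M L Q \<longleftrightarrow>
     prob_space.indep_set M
       {L -` A \<inter> space M | A. A \<in> sets borel}
       {(\<lambda>\<omega>. \<lambda>l\<in>{0..}. Q l \<omega>) -` B \<inter> space M | B. B \<in> sets (\<Pi>\<^sub>M l\<in>{0..}. borel)}"

end

theory Submission
  imports Defs
begin

text \<open>
  Fix a path with weak derivative \<open>g\<close>. Testing against smooth approximations of indicators shows
  that its increments are the integrals of \<open>g\<close>, and Tonelli applied to the law of \<open>L\<close> alone gives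
  that the weighted integral of \<open>g\<close> over \<open>{0<..L}\<close> has mean \<open>\<integral> g\<close>, the weight cancelling
  \<open>P(L \<ge> l)\<close>; this needs only \<open>g \<in> L\<^sup>1\<close>. To integrate over the paths as well, the weighted integral is
  written as a limit of Stieltjes sums of \<open>Q\<close>: these depend measurably on \<open>L\<close> and on the path, so
  that independence of \<open>L\<close> and \<open>Q\<close> factorises the joint law although \<open>dQ\<close> itself is not assumed to
  be measurable in the sample point. Conversely, if the mean of independent identically distributed
  terms is integrable then so is each term, and Fubini's theorem applies.
\<close>

section \<open>Smooth steps\<close>

text \<open>The order of integration is forced. The map from level and sample point to
  \<open>dQ l \<omega>\<close> is not known to be jointly measurable, so Fubini over levels and
  paths together is out of reach. Product integration happens only in two safe settings: over end
  point and level with the path frozen, where a Borel representative of its derivative can be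
  chosen, and over end point and path, where the integrand is a limit of sums of finitely many
  values of \<open>Q\<close>. The weight is unbounded in the level, but it is nondecreasing and
  left-continuous. Monotonicity bounds it on \<open>{0<..x}\<close> by its value at
  \<open>x\<close>, which yields dominated convergence; left continuity makes sums with left end
  points converge to the right limit. Integrability of the estimator does not control the mean of
  the L1 norm of \<open>dQ\<close>, because the weighted integrals may cancel. The identity is
  therefore drawn from integrability of the weighted integral alone, together with the L1 property
  of each single path.\<close>

definition smooth_fun :: "(real \<Rightarrow> real) \<Rightarrow> bool" where
  "smooth_fun f \<longleftrightarrow> (\<forall>n x. (deriv ^^ n) f differentiable (at x))"

text \<open>A class of differentiable functions closed under \<open>deriv\<close> contains all
  iterated derivatives of its members, so no formula for the n-th derivative is ever needed.\<close>

lemma smooth_funI_closed: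
  assumes "f \<in> F"
    and "\<And>h x. h \<in> F \<Longrightarrow> h differentiable (at x)"
    and "\<And>h. h \<in> F \<Longrightarrow> deriv h \<in> F"
  shows "smooth_fun f"
proof -
  have "(deriv ^^ n) f \<in> F" for n
    by (induction n) (use assms in auto)
  then show ?thesis
    using assms(2) by (auto simp: smooth_fun_def)
qed

lemma smooth_fun_differentiable: "smooth_fun f \<Longrightarrow> f differentiable (at x)"
  unfolding smooth_fun_def by (metis funpow_0)

lemma smooth_fun_deriv: "smooth_fun f \<Longrightarrow> smooth_fun (deriv f)"
  unfolding smooth_fun_def by (metis funpow_Suc_right o_apply)

lemma smooth_fun_has_real_derivative:
  "smooth_fun f \<Longrightarrow> (f has_real_derivative deriv f x) (at x)"
  using smooth_fun_differentiable
  by (metis DERIV_deriv_iff_real_differentiable)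

lemma smooth_fun_antiderivative:
  assumes "\<And>x. (f has_real_derivative h x) (at x)" "smooth_fun h"
  shows "smooth_fun f"
proof -
  have "deriv f = h"
    using assms(1) by (auto intro: DERIV_imp_deriv)
  then have "(deriv ^^ n) f differentiable (at x)" for n x
  proof (cases n)
    case 0
    then show ?thesis
      using assms(1) by (auto simp: real_differentiable_def)
  next
    case (Suc m)
    then show ?thesis
      using assms(2) \<open>deriv f = h\<close>
      by (simp add: smooth_fun_def funpow_swap1 del: funpow.simps add: funpow_Suc_right)
  qed
  then show ?thesis
    by (simp add: smooth_fun_def)
qed

section \<open>Closure properties of smooth functions\<close>

lemma smooth_fun_comp_affine:
  assumes "smooth_fun f"
  shows "smooth_fun (\<lambda>x. f (c * x + d))"
proof (rule smooth_funI_closed)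
  \<comment> \<open>The free factor \<open>k\<close> absorbs the inner derivative \<open>c\<close>
    that each differentiation produces.\<close>
  let ?F = "{\<lambda>x. k * h (c * x + d) | k h. smooth_fun h}"
  have D: "((\<lambda>x. k * h (c * x + d)) has_real_derivative (k * c) * deriv h (c * x + d)) (at x)"
    if "smooth_fun h" for k h x
    by (rule derivative_eq_intros DERIV_chain2[OF smooth_fun_has_real_derivative[OF that]] refl
        | simp)+
  show "(\<lambda>x. f (c * x + d)) \<in> ?F"
    using assms by (intro CollectI exI[of _ 1] exI[of _ f]) simp
  show "h differentiable (at x)" if "h \<in> ?F" for h x
    using that D by (auto simp: real_differentiable_def)
  show "deriv h \<in> ?F" if "h \<in> ?F" for h
  proof -
    from that obtain k u where h: "h = (\<lambda>x. k * u (c * x + d))" and u: "smooth_fun u" by auto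
    have "deriv h = (\<lambda>x. (k * c) * deriv u (c * x + d))"
      unfolding h using D[OF u] by (auto intro: DERIV_imp_deriv)
    then show ?thesis
      using smooth_fun_deriv[OF u] by blast
  qed
qed

text \<open>This set is closed under differentiation, which makes a general Leibniz formula superfluous.\<close>

inductive_set sums_of_smooth_products :: "(real \<Rightarrow> real) set" where
  prod: "smooth_fun a \<Longrightarrow> smooth_fun b \<Longrightarrow> (\<lambda>x. a x * b x) \<in> sums_of_smooth_products"
| add: "f \<in> sums_of_smooth_products \<Longrightarrow> h \<in> sums_of_smooth_products
    \<Longrightarrow> (\<lambda>x. f x + h x) \<in> sums_of_smooth_products"

lemma sums_of_smooth_products_smooth:
  assumes "f \<in> sums_of_smooth_products"
  shows "smooth_fun f"
proof (rule smooth_funI_closed[OF assms])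
  have *: "(\<forall>x. h differentiable (at x)) \<and> deriv h \<in> sums_of_smooth_products"
    if "h \<in> sums_of_smooth_products" for h
    using that
  proof induction
    case (prod a b)
    have D: "((\<lambda>x. a x * b x) has_real_derivative deriv a x * b x + a x * deriv b x) (at x)" for x
      using DERIV_mult[OF smooth_fun_has_real_derivative smooth_fun_has_real_derivative, OF prod]
      by (simp add: mult.commute add.commute)
    then have "deriv (\<lambda>x. a x * b x) = (\<lambda>x. deriv a x * b x + a x * deriv b x)"
      by (auto intro: DERIV_imp_deriv)
    then show ?case
      using D prod
      by (auto simp: real_differentiable_def
          intro!: sums_of_smooth_products.add sums_of_smooth_products.prod smooth_fun_deriv)
  next
    case (add f h)
    then have "((\<lambda>x. f x + h x) has_real_derivative deriv f x + deriv h x) (at x)" for x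
      by (intro DERIV_add) (simp_all add: DERIV_deriv_iff_real_differentiable)
    moreover from this have "deriv (\<lambda>x. f x + h x) = (\<lambda>x. deriv f x + deriv h x)"
      by (auto intro: DERIV_imp_deriv)
    ultimately show ?case
      using add by (auto simp: real_differentiable_def intro!: sums_of_smooth_products.intros)
  qed
  show "h differentiable (at x)" if "h \<in> sums_of_smooth_products" for h x
    using *[OF that] by auto
  show "deriv h \<in> sums_of_smooth_products" if "h \<in> sums_of_smooth_products" for h
    using *[OF that] by auto
qed

lemma smooth_fun_mult: "smooth_fun a \<Longrightarrow> smooth_fun b \<Longrightarrow> smooth_fun (\<lambda>x. a x * b x)"
  by (rule sums_of_smooth_products_smooth[OF sums_of_smooth_products.prod])

lemma smooth_fun_const: "smooth_fun (\<lambda>x. c)"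
  by (rule smooth_funI_closed[of _ "range (\<lambda>c x. c)"]) auto

lemma smooth_fun_diff: 
  assumes "smooth_fun a" "smooth_fun b"
  shows "smooth_fun (\<lambda>x. a x - b x)"
proof -
  have "(\<lambda>x. a x * 1 + b x * (- 1)) \<in> sums_of_smooth_products"
    by (intro sums_of_smooth_products.add sums_of_smooth_products.prod smooth_fun_const assms)
  then show ?thesis
    using sums_of_smooth_products_smooth by fastforce
qed

section \<open>Functions that are flat at the origin\<close>

definition flat_poly :: "real poly \<Rightarrow> real \<Rightarrow> real" where
  "flat_poly p x = (if x > 0 then poly p (1 / x) * exp (- (1 / x)) else 0)"

lemma poly_exp_tendsto_0:
  fixes p :: "real poly"
  shows "((\<lambda>t. poly p t * exp (- t)) \<longlongrightarrow> 0) at_top"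
proof -
  have "((\<lambda>t::real. \<Sum>i\<le>degree p. coeff p i * (t ^ i / exp t)) \<longlongrightarrow> 0) at_top"
    by (intro tendsto_null_sum tendsto_mult_right_zero tendsto_power_div_exp_0)
  then show ?thesis
    by (simp add: poly_altdef sum_distrib_right sum_divide_distrib exp_minus divide_inverse mult.assoc)
qed

text \<open>With \<open>t = 1 / x\<close> one has \<open>d/dx = - t^2 d/dt\<close>, which turns
  \<open>p(t) exp(-t)\<close> into \<open>t^2 (p - p')(t) exp(-t)\<close>; the factor
  \<open>[:0, 0, 1:]\<close> is \<open>t^2\<close>. Polynomials in \<open>1 / x\<close> thus make
  the class around exp (- 1 / x) closed under differentiation.\<close>

lemma flat_poly_has_derivative:
  "(flat_poly p has_real_derivative flat_poly ([:0, 0, 1:] * (p - pderiv p)) x) (at x)"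
proof -
  consider "x > 0" | "x < 0" | "x = 0" by linarith
  then show ?thesis
  proof cases
    case 1
    have "((\<lambda>x. poly p (1 / x) * exp (- (1 / x))) has_real_derivative
        flat_poly ([:0, 0, 1:] * (p - pderiv p)) x) (at x)"
      using 1 unfolding flat_poly_def
      by (auto intro!: derivative_eq_intros DERIV_chain2[OF poly_DERIV]
          simp: field_simps power2_eq_square)
    moreover have "\<forall>\<^sub>F y in nhds x. flat_poly p y = poly p (1 / y) * exp (- (1 / y))"
      using eventually_nhds_in_open[of "{0<..}" x] 1
      by (auto elim!: eventually_mono simp: flat_poly_def)
    ultimately show ?thesis
      using DERIV_cong_ev[of x x "flat_poly p" "\<lambda>x. poly p (1 / x) * exp (- (1 / x))"] by blast
  next
    case 2
    have "\<forall>\<^sub>F y in nhds x. flat_poly p y = 0"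
      using eventually_nhds_in_open[of "{..<0}" x] 2
      by (auto elim!: eventually_mono simp: flat_poly_def)
    then show ?thesis
      using DERIV_cong_ev[of x x "flat_poly p" "\<lambda>_. 0"] 2 by (simp add: flat_poly_def)
  next
    case 3
    \<comment> \<open>The right difference quotient at 0 is \<open>t p(t) exp(-t)\<close> with
      \<open>t = 1 / h\<close>; the extra factor \<open>t\<close> is the
      \<open>pCons 0\<close>.\<close>
    have "((\<lambda>h. poly (pCons 0 p) (inverse h) * exp (- (inverse h))) \<longlongrightarrow> 0) (at_right (0::real))"
      by (rule filterlim_compose[OF poly_exp_tendsto_0 filterlim_inverse_at_top_right])
    then have R: "((\<lambda>h. flat_poly p h / h) \<longlongrightarrow> 0) (at_right 0)"
      by (rule Lim_transform_eventually)
        (auto simp: eventually_at_filter flat_poly_def field_simps)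
    have L: "((\<lambda>h. flat_poly p h / h) \<longlongrightarrow> 0) (at_left 0)"
      by (rule Lim_transform_eventually[OF tendsto_const])
        (auto simp: eventually_at_filter flat_poly_def)
    from L R have "((\<lambda>h. flat_poly p h / h) \<longlongrightarrow> 0) (at 0)"
      by (rule filterlim_split_at)
    then show ?thesis
      using 3 by (simp add: DERIV_def) (simp add: flat_poly_def)
  qed
qed

lemma smooth_flat_poly: "smooth_fun (flat_poly p)"
proof (rule smooth_funI_closed[of _ "range flat_poly"])
  show "h differentiable (at x)" if "h \<in> range flat_poly" for h x
    using that flat_poly_has_derivative by (auto simp: real_differentiable_def)
  show "deriv h \<in> range flat_poly" if "h \<in> range flat_poly" for h
  proof -
    from that obtain p where h: "h = flat_poly p" by auto
    have "deriv h = flat_poly ([:0, 0, 1:] * (p - pderiv p))"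
      unfolding h using flat_poly_has_derivative by (auto intro: DERIV_imp_deriv)
    then show ?thesis by simp
  qed
qed auto

text \<open>The step is the normalised antiderivative of a bump. The support of
  \<open>\<rho>\<close> lies to the right of 0, so a copy of it moved to a positive point and
  compressed stays inside the open half-line.\<close>

lemma smooth_step_exists:
  obtains \<Phi> \<rho> :: "real \<Rightarrow> real"
  where "smooth_fun \<Phi>" "\<And>x. (\<Phi> has_real_derivative \<rho> x) (at x)"
    "\<And>x. x \<le> 0 \<Longrightarrow> \<Phi> x = 0" "\<And>x. x \<ge> 1 \<Longrightarrow> \<Phi> x = 1" "\<And>x. 0 \<le> \<Phi> x \<and> \<Phi> x \<le> 1"
    "continuous_on UNIV \<rho>" "\<And>x. x \<notin> {0..1} \<Longrightarrow> \<rho> x = 0"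
    "integrable lborel \<rho>" "integral\<^sup>L lborel \<rho> = 1"
proof -
  define b where "b x = flat_poly 1 x * flat_poly 1 (1 - x)" for x
  have b_smooth: "smooth_fun b"
    unfolding b_def
    using smooth_fun_mult[OF smooth_flat_poly smooth_fun_comp_affine[OF smooth_flat_poly, of _ "-1" 1]]
    by simp
  have b_cont: "continuous_on S b" for S
    using smooth_fun_differentiable[OF b_smooth]
    by (meson continuous_at_imp_continuous_on differentiable_imp_continuous_within)
  have b_pos: "b x > 0" if "0 < x" "x < 1" for x
    using that by (simp add: b_def flat_poly_def)
  have b_zero: "b x = 0" if "x \<le> 0 \<or> x \<ge> 1" for x
    using that by (auto simp: b_def flat_poly_def)
  have b_nonneg: "b x \<ge> 0" for x
    using b_pos[of x] b_zero[of x] by fastforce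
  \<comment> \<open>Starting at -1, left of the support, puts 0 in the interior of the interval of
    integration, so the fundamental theorem gives a two-sided derivative there.\<close>
  define B where "B x = integral {-1..x} b" for x
  have B0: "B x = 0" if "x \<le> 0" for x
  proof -
    have "B x = integral {-1..x} (\<lambda>_. 0)"
      unfolding B_def
      by (rule Henstock_Kurzweil_Integration.integral_cong) (use that b_zero in auto)
    then show ?thesis by simp
  qed
  have Bd: "(B has_real_derivative b x) (at x)" for x
  proof (cases "x > -1")
    case True
    have "(B has_vector_derivative b x) (at x within {-1..x+1})"
      unfolding B_def by (rule integral_has_vector_derivative) (use True b_cont in auto)
    then show ?thesis
      using True at_within_interior[of x "{-1..x+1}"]
      by (simp add: has_real_derivative_iff_has_vector_derivative)
  next
    case False
    have "\<forall>\<^sub>F y in nhds x. B y = 0"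
      using eventually_nhds_in_open[of "{..<0}" x] False
      by (auto elim!: eventually_mono simp: B0)
    then show ?thesis
      using DERIV_cong_ev[of x x B "\<lambda>_. 0"] False by (simp add: b_zero)
  qed
  have B_mono: "B x \<le> B y" if "x \<le> y" for x y
    by (rule DERIV_nonneg_imp_nondecreasing[OF that]) (use Bd b_nonneg in blast)
  have B1: "B x = B 1" if "x \<ge> 1" for x
  proof -
    have "integral {1..x} b = integral {1..x} (\<lambda>_. 0::real)"
      by (rule Henstock_Kurzweil_Integration.integral_cong) (auto simp: b_zero)
    moreover have "integral {-1..1} b + integral {1..x} b = integral {-1..x} b"
      by (rule Henstock_Kurzweil_Integration.integral_combine)
        (use that b_cont in \<open>auto intro!: integrable_continuous_real\<close>)
    ultimately show ?thesis by (simp add: B_def)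
  qed
  have B1_pos: "B 1 > 0"
  proof -
    have "B 0 < B (1/2)"
    proof (rule DERIV_pos_imp_increasing_open[of 0 "1/2" B])
      show "continuous_on {0..1 / 2} B"
        using Bd by (meson DERIV_isCont continuous_at_imp_continuous_on)
    qed (use Bd b_pos in \<open>auto intro!: exI[of _ "b _"]\<close>)
    then show ?thesis
      using B_mono[of "1/2" 1] B0[of 0] by simp
  qed
  have b_eq: "(\<lambda>x. if x \<in> {-1..1} then b x else 0) = b"
  proof
    show "(if x \<in> {-1..1} then b x else 0) = b x" for x
      by (cases "x \<le> 0 \<or> x \<ge> 1") (auto simp: b_zero)
  qed
  have b_ind: "(\<lambda>x. indicator {-1..1} x *\<^sub>R b x) = b"
    using b_eq unfolding indicator_scaleR_eq_if .
  have b_int: "integrable lborel b"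
    using borel_integrable_compact[OF compact_Icc b_cont, of "-1" 1] unfolding b_ind .
  have "integral\<^sup>L lborel b = integral UNIV b"
    by (rule integral_lborel[OF b_int, symmetric])
  also have "\<dots> = B 1"
    using integral_restrict_UNIV[of "{-1..1}" b] unfolding b_eq by (simp add: B_def)
  finally have b_integral: "integral\<^sup>L lborel b = B 1" .
  show ?thesis
  proof (rule that[of "\<lambda>x. B x / B 1" "\<lambda>x. b x / B 1"])
    show d: "((\<lambda>x. B x / B 1) has_real_derivative b x / B 1) (at x)" for x
      using Bd by (rule DERIV_cdivide)
    have "smooth_fun (\<lambda>x. b x * (1 / B 1))"
      by (intro smooth_fun_mult b_smooth smooth_fun_const)
    then show "smooth_fun (\<lambda>x. B x / B 1)"
      using smooth_fun_antiderivative[OF d] by simp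
    show "0 \<le> B x / B 1 \<and> B x / B 1 \<le> 1" for x
    proof -
      have "B x \<ge> 0"
        using B_mono[of 0 x] B0[of 0] B0[of x] by (cases "x \<ge> 0") auto
      moreover have "B x \<le> B 1"
        using B_mono[of x 1] B1[of x] by (cases "x \<ge> 1") auto
      ultimately show ?thesis using B1_pos by auto
    qed
    show "continuous_on UNIV (\<lambda>x. b x / B 1)"
      using B1_pos by (intro continuous_intros b_cont) auto
    show "b x / B 1 = 0" if "x \<notin> {0..1}" for x
      using that b_zero by auto
    show "B x / B 1 = 1" if "1 \<le> x" for x
      using B1[OF that] B1_pos by simp
  qed (use B0 B1_pos b_int b_integral in auto)
qed

section \<open>Weak derivatives on the half-line\<close>

text \<open>The rescaled kernels are an approximate identity that concentrates at \<open>c\<close>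
  from the right. Substituting \<open>x = c + y / (n + 1)\<close> moves the dependence on
  \<open>n\<close> into the argument of \<open>f\<close>, where continuity at \<open>c\<close> and
  dominated convergence apply.\<close>

lemma rescaled_bump:
  fixes f \<rho> :: "real \<Rightarrow> real"
  assumes f: "continuous_on {0<..} f" and c: "0 < c"
    and \<rho>: "continuous_on UNIV \<rho>" "\<And>x. x \<notin> {0..1} \<Longrightarrow> \<rho> x = 0"
      "integrable lborel \<rho>" "integral\<^sup>L lborel \<rho> = 1"
  shows "set_integrable lebesgue {0<..} (\<lambda>x. f x * (real (Suc n) * \<rho> (real (Suc n) * (x - c))))"
    and "(\<lambda>n. LINT x:{0<..}|lebesgue. f x * (real (Suc n) * \<rho> (real (Suc n) * (x - c))))
      \<longlonglongrightarrow> f c"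
proof -
  \<comment> \<open>Extension by zero makes \<open>f\<close> Borel on the whole line, as the affine
    substitution for \<open>lborel\<close> and the passage from \<open>lebesgue\<close>
    require.\<close>
  define h where "h x = indicator {0<..} x * f x" for x :: real
  have h_meas[measurable]: "h \<in> borel_measurable borel"
    using borel_measurable_continuous_on_indicator[OF _ f] unfolding h_def by simp
  have \<rho>_meas[measurable]: "\<rho> \<in> borel_measurable borel"
    using \<rho>(1) by (rule borel_measurable_continuous_onI)
  define u where "u n x = h x * (real (Suc n) * \<rho> (real (Suc n) * (x - c)))" for n x
  have u_meas[measurable]: "u n \<in> borel_measurable borel" for n
    unfolding u_def by measurable
  have u_eq: "indicator {0<..} x *\<^sub>R (f x * (real (Suc n) * \<rho> (real (Suc n) * (x - c)))) = u n x"
    for n x by (simp add: u_def h_def)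
  have u_int: "integrable lborel (u n)" for n
  proof -
    have "u n = (\<lambda>x. indicator {c..c+1} x *\<^sub>R
        (f x * (real (Suc n) * \<rho> (real (Suc n) * (x - c)))))"
    proof
      fix x
      show "u n x = indicator {c..c+1} x *\<^sub>R
        (f x * (real (Suc n) * \<rho> (real (Suc n) * (x - c))))"
      proof (cases "x \<in> {c..c+1}")
        case False
        have "real (Suc n) * (x - c) \<notin> {0..1}"
        proof
          assume *: "real (Suc n) * (x - c) \<in> {0..1}"
          then have "x - c \<ge> 0" by (simp add: zero_le_mult_iff)
          moreover from this have "1 * (x - c) \<le> real (Suc n) * (x - c)"
            by (intro mult_right_mono) auto
          ultimately show False using * False by auto
        qed
        then show ?thesis using False \<rho>(2) by (auto simp: u_def)
      qed (use c in \<open>simp add: u_def h_def\<close>)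
    qed
    moreover have "integrable lborel (\<lambda>x. indicator {c..c+1} x *\<^sub>R
        (f x * (real (Suc n) * \<rho> (real (Suc n) * (x - c)))))"
    proof (rule borel_integrable_compact)
      show "continuous_on {c..c+1} (\<lambda>x. f x * (real (Suc n) * \<rho> (real (Suc n) * (x - c))))"
        by (intro continuous_intros continuous_on_subset[OF f]
            continuous_on_compose2[OF \<rho>(1)]) (use c in auto)
    qed simp
    ultimately show ?thesis by simp
  qed
  show "set_integrable lebesgue {0<..} (\<lambda>x. f x * (real (Suc n) * \<rho> (real (Suc n) * (x - c))))"
    unfolding set_integrable_def u_eq using integrable_completion[of "u n" lborel] u_int by simp
  have u_integral: "(LINT x:{0<..}|lebesgue. f x * (real (Suc n) * \<rho> (real (Suc n) * (x - c))))
      = (\<integral>y. h (c + y / real (Suc n)) * \<rho> y \<partial>lborel)" for n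
  proof -
    have "(LINT x:{0<..}|lebesgue. f x * (real (Suc n) * \<rho> (real (Suc n) * (x - c))))
      = integral\<^sup>L lborel (u n)"
      unfolding set_lebesgue_integral_def u_eq by (rule integral_completion) simp
    also have "\<dots> = \<bar>1 / real (Suc n)\<bar> *\<^sub>R (\<integral>y. u n (c + (1 / real (Suc n)) * y) \<partial>lborel)"
      by (rule lborel_integral_real_affine) simp
    also have "\<dots> = (\<integral>y. h (c + y / real (Suc n)) * \<rho> y \<partial>lborel)"
      unfolding u_def by (simp add: field_simps flip: integral_mult_right_zero del: of_nat_Suc)
    finally show ?thesis .
  qed
  \<comment> \<open>Since \<open>n + 1\<close> is at least 1, all rescaled kernels live on this one
    compact interval, so a single bound for \<open>f\<close> dominates the whole sequence.\<close>
  have "continuous_on {c..c+1} f"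
    by (rule continuous_on_subset[OF f]) (use c in auto)
  then have "bounded (f ` {c..c+1})"
    by (intro compact_imp_bounded compact_continuous_image) auto
  then obtain B where B: "\<forall>x\<in>{c..c+1}. \<bar>f x\<bar> \<le> B"
    by (auto simp: bounded_iff)
  have f_at: "isCont f c"
    using f c by (simp add: continuous_on_eq_continuous_at)
  have "(\<lambda>n. \<integral>y. h (c + y / real (Suc n)) * \<rho> y \<partial>lborel) \<longlonglongrightarrow> (\<integral>y. f c * \<rho> y \<partial>lborel)"
  proof (rule integral_dominated_convergence[where w="\<lambda>y. B * \<bar>\<rho> y\<bar>"])
    show "integrable lborel (\<lambda>y. B * \<bar>\<rho> y\<bar>)"
      using \<rho>(3) by auto
    show "AE y in lborel. (\<lambda>n. h (c + y / real (Suc n)) * \<rho> y) \<longlonglongrightarrow> f c * \<rho> y"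
    proof (rule AE_I2)
      fix y :: real
      show "(\<lambda>n. h (c + y / real (Suc n)) * \<rho> y) \<longlonglongrightarrow> f c * \<rho> y"
      proof (cases "y \<in> {0..1}")
        case True
        have "(\<lambda>n. y * inverse (real (Suc n))) \<longlonglongrightarrow> y * 0"
          by (intro tendsto_intros LIMSEQ_inverse_real_of_nat)
        then have "(\<lambda>n. c + y / real (Suc n)) \<longlonglongrightarrow> c + 0"
          by (intro tendsto_intros) (simp add: divide_inverse)
        then have "(\<lambda>n. f (c + y / real (Suc n))) \<longlonglongrightarrow> f c"
          using isCont_tendsto_compose[OF f_at] by simp
        moreover have "h (c + y / real (Suc n)) = f (c + y / real (Suc n))" for n
        proof -
          have "y / real (Suc n) \<ge> 0" using True by simp
          then have "c + y / real (Suc n) > 0" using c by linarith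
          then show ?thesis by (simp add: h_def)
        qed
        ultimately show ?thesis by (intro tendsto_intros) simp
      qed (use \<rho>(2) in simp)
    qed
    show "AE y in lborel. norm (h (c + y / real (Suc n)) * \<rho> y) \<le> B * \<bar>\<rho> y\<bar>" for n
    proof (rule AE_I2)
      fix y :: real
      show "norm (h (c + y / real (Suc n)) * \<rho> y) \<le> B * \<bar>\<rho> y\<bar>"
      proof (cases "y \<in> {0..1}")
        case True
        have "y / real (Suc n) \<le> y / 1"
          by (rule divide_left_mono) (use True in auto)
        then have *: "c + y / real (Suc n) \<in> {c..c+1}" using True by auto
        then have "\<bar>h (c + y / real (Suc n))\<bar> = \<bar>f (c + y / real (Suc n))\<bar>"
          using c by (simp add: h_def)
        then have "\<bar>h (c + y / real (Suc n))\<bar> \<le> B" using bspec[OF B *] by simp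
        then show ?thesis
          by (simp add: abs_mult mult_right_mono del: of_nat_Suc)
      qed (use \<rho>(2) in simp)
    qed
  qed measurable
  then show "(\<lambda>n. LINT x:{0<..}|lebesgue. f x * (real (Suc n) * \<rho> (real (Suc n) * (x - c))))
      \<longlonglongrightarrow> f c"
    unfolding u_integral by (simp add: \<rho>(4))
qed

lemma weak_derivative_set_integrable:
  assumes "has_weak_derivative_on f g {0<..}" "0 < a"
  shows "set_integrable lebesgue {a<..b} g"
proof -
  have "set_integrable lebesgue {a..b} g"
    using assms unfolding has_weak_derivative_on_def by (auto dest!: spec[of _ "{a..b}"])
  then show ?thesis
    by (rule set_integrable_subset) auto
qed

text \<open>Testing against smooth approximations of the indicator of \<open>{a<..b}\<close>, whose derivatives
  concentrate at \<open>a\<close> and \<open>b\<close>.\<close>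

lemma weak_derivative_increment:
  fixes f g :: "real \<Rightarrow> real"
  assumes f: "continuous_on {0<..} f" and fg: "has_weak_derivative_on f g {0<..}"
    and ab: "0 < a" "a \<le> b"
  shows "f b - f a = (LINT x:{a<..b}|lebesgue. g x)"
proof -
  obtain \<Phi> \<rho> :: "real \<Rightarrow> real"
    where smooth: "smooth_fun \<Phi>" and D: "\<And>x. (\<Phi> has_real_derivative \<rho> x) (at x)"
    and \<Phi>0: "\<And>x. x \<le> 0 \<Longrightarrow> \<Phi> x = 0" and \<Phi>1: "\<And>x. x \<ge> 1 \<Longrightarrow> \<Phi> x = 1"
    and \<Phi>b: "\<And>x. 0 \<le> \<Phi> x \<and> \<Phi> x \<le> 1"
    and \<rho>: "continuous_on UNIV \<rho>" "\<And>x. x \<notin> {0..1} \<Longrightarrow> \<rho> x = 0"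
      "integrable lborel \<rho>" "integral\<^sup>L lborel \<rho> = 1"
    by (rule smooth_step_exists) blast
  \<comment> \<open>Each step rises to the right of its point, over a length of at most 1: the
    support stays in \<open>{a..b+1}\<close>, and the pointwise limit is exactly the indicator of
    the half-open interval, with value 0 at \<open>a\<close> and 1 at \<open>b\<close> (for
    \<open>a < b\<close>).\<close>
  define \<phi> where "\<phi> n x = \<Phi> (real (Suc n) * (x - a)) - \<Phi> (real (Suc n) * (x - b))" for n x
  define \<psi> where "\<psi> c n x = real (Suc n) * \<rho> (real (Suc n) * (x - c))" for c n x
  have "smooth_fun (\<lambda>x. \<Phi> (real (Suc n) * (x - c)))" for n c
    using smooth_fun_comp_affine[OF smooth, of "real (Suc n)" "- real (Suc n) * c"]
    by (simp add: algebra_simps)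
  then have smooth_\<phi>: "smooth_fun (\<phi> n)" for n
    unfolding \<phi>_def by (intro smooth_fun_diff)
  have \<phi>_zero: "\<phi> n x = 0" if "x \<notin> {a..b+1}" for n x
  proof (cases "x < a")
    case True
    then have "real (Suc n) * (x - a) \<le> 0" "real (Suc n) * (x - b) \<le> 0"
      using ab by (auto simp: mult_le_0_iff)
    then show ?thesis by (simp add: \<phi>_def \<Phi>0)
  next
    case False
    then have x: "x > b + 1" using that by simp
    have "1 * 1 \<le> real (Suc n) * (x - a)" "1 * 1 \<le> real (Suc n) * (x - b)"
      by (intro mult_mono; use x ab in simp)+
    then show ?thesis by (simp add: \<phi>_def \<Phi>1)
  qed
  have test: "test_function_on {0<..} (\<phi> n)" for n
    unfolding test_function_on_def
    using smooth_\<phi>[of n, unfolded smooth_fun_def] \<phi>_zero[of _ n] ab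
    by (auto intro!: exI[of _ "{a..b+1}"])
  have deriv_\<phi>: "deriv (\<phi> n) x = \<psi> a n x - \<psi> b n x" for n x
  proof -
    have "((\<lambda>x. \<Phi> (real (Suc n) * (x - c))) has_real_derivative \<psi> c n x) (at x)" for c
    proof -
      have "((\<lambda>x. real (Suc n) * (x - c)) has_real_derivative real (Suc n)) (at x)"
        by (auto intro!: derivative_eq_intros)
      from DERIV_chain2[OF D this] show ?thesis
        by (simp add: \<psi>_def mult.commute)
    qed
    then show ?thesis
      unfolding \<phi>_def by (intro DERIV_imp_deriv DERIV_diff)
  qed
  have ab': "0 < b" using ab by simp
  note bump_a = rescaled_bump[OF f ab(1) \<rho>, folded \<psi>_def]
  note bump_b = rescaled_bump[OF f ab' \<rho>, folded \<psi>_def]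
  have split: "(LINT x:{0<..}|lebesgue. f x * deriv (\<phi> n) x) =
      (LINT x:{0<..}|lebesgue. f x * \<psi> a n x) - (LINT x:{0<..}|lebesgue. f x * \<psi> b n x)" for n
    unfolding deriv_\<phi> right_diff_distrib
    by (rule set_integral_diff(2)[OF bump_a(1) bump_b(1)])
  have lim1: "(\<lambda>n. LINT x:{0<..}|lebesgue. f x * deriv (\<phi> n) x) \<longlonglongrightarrow> f a - f b"
    unfolding split by (intro tendsto_diff bump_a(2) bump_b(2))
  \<comment> \<open>A weak derivative is integrable only over compact subsets; cutting
    \<open>g\<close> down to the common support of the test functions provides the integrable
    majorant.\<close>
  define G where "G x = indicator {a..b+1} x * g x" for x
  have G_int: "integrable lebesgue G"
    using fg ab unfolding has_weak_derivative_on_def set_integrable_def G_def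
    by (auto dest!: spec[of _ "{a..b+1}"])
  have G_eq: "indicator {0<..} x *\<^sub>R (g x * \<phi> n x) = G x * \<phi> n x" for n x
    using \<phi>_zero[of x n] ab by (auto simp: G_def indicator_def)
  have lim2: "(\<lambda>n. \<integral>x. G x * \<phi> n x \<partial>lebesgue) \<longlonglongrightarrow> (\<integral>x. indicator {a<..b} x *\<^sub>R g x \<partial>lebesgue)"
  proof (rule integral_dominated_convergence[where w="\<lambda>x. \<bar>G x\<bar>"])
    have "\<phi> n \<in> borel_measurable borel" for n
      using smooth_fun_differentiable[OF smooth_\<phi>]
      by (intro borel_measurable_continuous_onI)
        (meson continuous_at_imp_continuous_on differentiable_imp_continuous_within)
    then have [measurable]: "\<phi> n \<in> borel_measurable lebesgue" for n
      by (intro measurable_completion) simp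
    have [measurable]: "G \<in> borel_measurable lebesgue" using G_int by simp
    show "(\<lambda>x. G x * \<phi> n x) \<in> borel_measurable lebesgue" for n by measurable
    show "(\<lambda>x. indicator {a<..b} x *\<^sub>R g x) \<in> borel_measurable lebesgue"
      using weak_derivative_set_integrable[OF fg ab(1)]
      unfolding set_integrable_def by (rule borel_measurable_integrable)
    show "integrable lebesgue (\<lambda>x. \<bar>G x\<bar>)" using G_int by simp
    have "\<bar>\<phi> n x\<bar> \<le> 1" for n x
      using \<Phi>b[of "real (Suc n) * (x - a)"] \<Phi>b[of "real (Suc n) * (x - b)"]
      unfolding \<phi>_def by linarith
    then show "AE x in lebesgue. norm (G x * \<phi> n x) \<le> \<bar>G x\<bar>" for n
      by (auto simp: abs_mult mult_left_le)
    have ev1: "\<forall>\<^sub>F n in sequentially. \<Phi> (real (Suc n) * (x - c)) = 1" if "x > c" for x c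
    proof -
      have "filterlim (\<lambda>n. (x - c) * real (Suc n)) at_top sequentially"
        by (rule filterlim_tendsto_pos_mult_at_top[OF tendsto_const])
          (use that filterlim_compose[OF filterlim_real_sequentially filterlim_Suc] in auto)
      then have "\<forall>\<^sub>F n in sequentially. 1 \<le> (x - c) * real (Suc n)"
        by (simp add: filterlim_at_top)
      then show ?thesis
        by (rule eventually_mono) (simp add: \<Phi>1 mult.commute del: of_nat_Suc)
    qed
    have ev0: "\<forall>\<^sub>F n in sequentially. \<Phi> (real (Suc n) * (x - c)) = 0" if "x \<le> c" for x c
      using that by (intro always_eventually allI \<Phi>0) (simp add: mult_le_0_iff)
    have "\<forall>\<^sub>F n in sequentially. \<phi> n x = indicator {a<..b} x" for x
    proof -
      consider "x \<le> a" | "a < x" "x \<le> b" | "b < x" by linarith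
      then show ?thesis
      proof cases
        case 1
        then have "\<forall>\<^sub>F n in sequentially. \<Phi> (real (Suc n) * (x - a)) = 0 \<and> \<Phi> (real (Suc n) * (x - b)) = 0"
          using ab by (intro eventually_conj ev0) auto
        then show ?thesis by (rule eventually_mono) (use 1 in \<open>simp add: \<phi>_def\<close>)
      next
        case 2
        then have "\<forall>\<^sub>F n in sequentially. \<Phi> (real (Suc n) * (x - a)) = 1 \<and> \<Phi> (real (Suc n) * (x - b)) = 0"
          by (intro eventually_conj ev0 ev1) auto
        then show ?thesis by (rule eventually_mono) (use 2 in \<open>simp add: \<phi>_def\<close>)
      next
        case 3
        then have "\<forall>\<^sub>F n in sequentially. \<Phi> (real (Suc n) * (x - a)) = 1 \<and> \<Phi> (real (Suc n) * (x - b)) = 1"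
          using ab by (intro eventually_conj ev1) auto
        then show ?thesis by (rule eventually_mono) (use 3 in \<open>simp add: \<phi>_def\<close>)
      qed
    qed
    then have "(\<lambda>n. \<phi> n x) \<longlonglongrightarrow> indicator {a<..b} x" for x
      by (rule tendsto_eventually)
    then have "(\<lambda>n. G x * \<phi> n x) \<longlonglongrightarrow> G x * indicator {a<..b} x" for x
      by (intro tendsto_intros)
    moreover have "G x * indicator {a<..b} x = indicator {a<..b} x *\<^sub>R g x" for x
      by (auto simp: G_def indicator_def)
    ultimately show "AE x in lebesgue. (\<lambda>n. G x * \<phi> n x) \<longlonglongrightarrow> indicator {a<..b} x *\<^sub>R g x"
      by simp
  qed
  have "(LINT x:{0<..}|lebesgue. f x * deriv (\<phi> n) x) = - (\<integral>x. G x * \<phi> n x \<partial>lebesgue)" for n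
  proof -
    have "(LINT x:{0<..}|lebesgue. g x * \<phi> n x) = (\<integral>x. G x * \<phi> n x \<partial>lebesgue)"
      unfolding set_lebesgue_integral_def G_eq ..
    then show ?thesis
      using fg test[of n] by (simp add: has_weak_derivative_on_def)
  qed
  then have "(\<lambda>n. LINT x:{0<..}|lebesgue. f x * deriv (\<phi> n) x)
      \<longlonglongrightarrow> - (LINT x:{a<..b}|lebesgue. g x)"
    using tendsto_minus[OF lim2] by (simp add: set_lebesgue_integral_def)
  from LIMSEQ_unique[OF lim1 this] show ?thesis by simp
qed

section \<open>Uniqueness of weak derivatives\<close>

lemma AE_zero_if_Ioc_integrals_zero:
  fixes v :: "real \<Rightarrow> real"
  assumes v: "integrable lborel v"
    and zero: "\<And>a b. a \<le> b \<Longrightarrow> (LINT x:{a<..b}|lborel. v x) = 0"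
  shows "AE x in lborel. v x = 0"
proof -
  have [measurable]: "v \<in> borel_measurable borel" using v by simp
  have set_int: "set_integrable lborel A v" if "A \<in> sets borel" for A
    using that v integrable_mult_indicator[of A lborel v] by (simp add: set_integrable_def)
  \<comment> \<open>The total integral has to vanish for the complement case of the induction over
    Borel sets.\<close>
  have "(\<lambda>n. \<integral>x. indicator {- real n<..real n} x *\<^sub>R v x \<partial>lborel) \<longlonglongrightarrow> (\<integral>x. v x \<partial>lborel)"
  proof (rule integral_dominated_convergence[where w="\<lambda>x. \<bar>v x\<bar>"])
    show "AE x in lborel. (\<lambda>n. indicator {- real n<..real n} x *\<^sub>R v x) \<longlonglongrightarrow> v x"
    proof (rule AE_I2)
      fix x :: real
      obtain m :: nat where m: "\<bar>x\<bar> < real m" using reals_Archimedean2 by blast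
      have "\<forall>\<^sub>F n in sequentially. indicator {- real n<..real n} x *\<^sub>R v x = v x"
        using eventually_ge_at_top[of m] by (rule eventually_mono) (use m in \<open>auto simp: indicator_def\<close>)
      then show "(\<lambda>n. indicator {- real n<..real n} x *\<^sub>R v x) \<longlonglongrightarrow> v x"
        by (rule tendsto_eventually)
    qed
  qed (use v in \<open>auto simp: indicator_def\<close>)
  then have "(\<lambda>n. 0::real) \<longlonglongrightarrow> (\<integral>x. v x \<partial>lborel)"
    using zero by (simp add: set_lebesgue_integral_def)
  then have total: "(\<integral>x. v x \<partial>lborel) = 0"
    using LIMSEQ_unique tendsto_const by blast
  \<comment> \<open>A pi-lambda argument: half-open intervals, the empty ones included, form an
    intersection-stable generator of the Borel sets. With all Borel integrals zero, \<open>v\<close>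
    and 0 are densities of the same signed set function.\<close>
  have borel_zero: "(LINT x:A|lborel. v x) = 0" if "A \<in> sets borel" for A
  proof -
    define G where "G = range (\<lambda>(a, b). {a<..b::real})"
    have gen: "sigma_sets UNIV G = sets borel"
      unfolding borel_sigma_sets_Ioc G_def by (simp add: sets_measure_of)
    have "Int_stable G"
    proof (rule Int_stableI)
      fix A B assume "A \<in> G" "B \<in> G"
      then obtain a b c d where "A = {a<..b}" "B = {c<..d}" by (auto simp: G_def)
      then have "A \<inter> B = (\<lambda>(a, b). {a<..b}) (max a c, min b d)" by auto
      then show "A \<inter> B \<in> G" unfolding G_def by blast
    qed
    moreover have "G \<subseteq> Pow UNIV" by simp
    moreover have "A \<in> sigma_sets UNIV G" using that gen by simp
    ultimately show ?thesis
    proof (induction rule: sigma_sets_induct_disjoint)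
      case (basic A)
      then obtain a b where "A = {a<..b}" by (auto simp: G_def)
      then show ?case
        using zero[of a b] by (cases "a \<le> b") (auto simp: set_lebesgue_integral_def)
    next
      case empty
      then show ?case by (simp add: set_lebesgue_integral_def)
    next
      case (compl A)
      have "A \<in> sets borel" using compl gen by simp
      then have "(LINT x:A \<union> (UNIV - A)|lborel. v x)
          = (LINT x:A|lborel. v x) + (LINT x:UNIV - A|lborel. v x)"
        by (intro set_integral_Un set_int) auto
      then show ?case
        using compl total by (simp add: set_lebesgue_integral_def)
    next
      case (union A)
      have A: "A i \<in> sets borel" for i using union(2) gen by auto
      have "(LINT x:(\<Union>i. A i)|lborel. v x) = (\<Sum>i. LINT x:A i|lborel. v x)"
        by (rule lebesgue_integral_countable_add)
          (use A union(1) set_int in \<open>auto simp: disjoint_family_on_def\<close>)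
      then show ?case using union(3) by simp
    qed
  qed
  show ?thesis
    by (rule density_unique_real)
      (use v borel_zero in \<open>auto simp: set_lebesgue_integral_def\<close>)
qed

text \<open>Reduction to the global Borel case: cut off outside \<open>{s<..t}\<close>, pass to a
  Borel representative of the Lebesgue measurable function, and intersect an arbitrary interval with
  \<open>{s<..t}\<close>.\<close>

lemma AE_zero_on_if_Ioc_integrals_zero:
  fixes u :: "real \<Rightarrow> real"
  assumes u: "set_integrable lebesgue {s<..t} u"
    and zero: "\<And>a b. s \<le> a \<Longrightarrow> a \<le> b \<Longrightarrow> b \<le> t \<Longrightarrow> (LINT x:{a<..b}|lebesgue. u x) = 0"
  shows "AE x in lebesgue. x \<in> {s<..t} \<longrightarrow> u x = 0"
proof -
  define U where "U = (\<lambda>x. indicator {s<..t} x * u x)"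
  have U: "integrable lebesgue U"
    using u by (simp add: set_integrable_def U_def)
  obtain v where v[measurable]: "v \<in> borel_measurable lborel" and "AE x in lborel. U x = v x"
    using completion_ex_borel_measurable_real[OF borel_measurable_integrable[OF U]] by blast
  then have ae: "AE x in lebesgue. U x = v x" by (intro AE_completion)
  have v': "v \<in> borel_measurable lebesgue" using v by (intro measurable_completion) simp
  have "integrable lebesgue v"
    using integrable_cong_AE[OF borel_measurable_integrable[OF U] v' ae] U by simp
  then have v_int: "integrable lborel v"
    using integrable_completion[OF v] by simp
  have "AE x in lborel. v x = 0"
  proof (rule AE_zero_if_Ioc_integrals_zero[OF v_int])
    fix a b :: real assume "a \<le> b"
    have "(LINT x:{a<..b}|lborel. v x) = (LINT x:{a<..b}|lebesgue. v x)"
      unfolding set_lebesgue_integral_def by (rule integral_completion[symmetric]) measurable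
    also have "\<dots> = (LINT x:{a<..b}|lebesgue. U x)"
      unfolding set_lebesgue_integral_def
    proof (rule integral_cong_AE)
      show "AE x in lebesgue. indicat_real {a<..b} x *\<^sub>R v x = indicat_real {a<..b} x *\<^sub>R U x"
        using ae by eventually_elim simp
    qed (use v' U in \<open>auto intro!: borel_measurable_times borel_measurable_indicator\<close>)
    also have "\<dots> = (LINT x:{max a s<..min b t}|lebesgue. u x)"
      unfolding set_lebesgue_integral_def U_def
      by (rule Bochner_Integration.integral_cong) (auto simp: indicator_def)
    also have "\<dots> = 0"
    proof (cases "max a s \<le> min b t")
      case True
      then show ?thesis by (intro zero) auto
    next
      case False
      then have "{max a s<..min b t} = {}"
        by (intro greaterThanAtMost_empty) linarith
      then show ?thesis by (simp only: set_lebesgue_integral_def) simp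
    qed
    finally show "(LINT x:{a<..b}|lborel. v x) = 0" .
  qed
  then have "AE x in lebesgue. v x = 0" by (rule AE_completion)
  with ae show ?thesis
    by eventually_elim (auto simp: U_def)
qed

text \<open>The integral of any weak derivative over an interval is the increment of
  \<open>f\<close>, so two of them agree in all interval integrals. The intervals
  \<open>{1 / (n + 1)<..n}\<close> exhaust the half-line while staying away from 0, where
  integrability is not assumed.\<close>

lemma weak_derivative_unique:
  assumes f: "continuous_on {0<..} f"
    and g: "has_weak_derivative_on f g {0<..}" and g': "has_weak_derivative_on f g' {0<..}"
  shows "AE x in lebesgue. 0 < x \<longrightarrow> g x = g' x"
proof -
  have "AE x in lebesgue. x \<in> {1 / real (Suc n)<..real n} \<longrightarrow> g x - g' x = 0" for n
  proof (rule AE_zero_on_if_Ioc_integrals_zero)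
    show "set_integrable lebesgue {1 / real (Suc n)<..real n} (\<lambda>x. g x - g' x)"
      by (intro set_integral_diff weak_derivative_set_integrable[OF g]
          weak_derivative_set_integrable[OF g']) simp_all
    fix a b assume ab: "1 / real (Suc n) \<le> a" "a \<le> b" "b \<le> real n"
    have "0 < 1 / real (Suc n)" by simp
    with ab have a: "0 < a" by linarith
    have "(LINT x:{a<..b}|lebesgue. g x - g' x)
        = (LINT x:{a<..b}|lebesgue. g x) - (LINT x:{a<..b}|lebesgue. g' x)"
      by (intro set_integral_diff weak_derivative_set_integrable[OF g a]
          weak_derivative_set_integrable[OF g' a])
    then show "(LINT x:{a<..b}|lebesgue. g x - g' x) = 0"
      using weak_derivative_increment[OF f g a ab(2)] weak_derivative_increment[OF f g' a ab(2)]
      by simp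
  qed
  then have "AE x in lebesgue. \<forall>n. x \<in> {1 / real (Suc n)<..real n} \<longrightarrow> g x - g' x = 0"
    unfolding AE_all_countable ..
  then show ?thesis
  proof eventually_elim
    fix x assume *: "\<forall>n. x \<in> {1 / real (Suc n)<..real n} \<longrightarrow> g x - g' x = 0"
    show "0 < x \<longrightarrow> g x = g' x"
    proof
      assume x: "0 < x"
      obtain n where n: "max x (1 / x) < real n" using reals_Archimedean2 by blast
      then have "1 / x < real (Suc n)" by simp
      then have "1 / real (Suc n) < x" using x by (simp add: field_simps del: of_nat_Suc)
      then show "g x = g' x" using * n by auto
    qed
  qed
qed

text \<open>\<open>sobolev_W11\<close> promises only some globally integrable weak derivative;
  uniqueness passes the property on to the given one. Its measurability on the whole half-line is
  first recovered as a limit of truncations to intervals away from 0 and infinity.\<close>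

lemma sobolev_weak_derivative_integrable:
  assumes f: "continuous_on {0<..} f" "f \<in> sobolev_W11 {0<..}"
    and g: "has_weak_derivative_on f g {0<..}"
  shows "set_integrable lebesgue {0<..} g"
proof -
  obtain g' where g': "set_integrable lebesgue {0<..} g'" "has_weak_derivative_on f g' {0<..}"
    using f(2) by (auto simp: sobolev_W11_def)
  have meas: "(\<lambda>x. indicator {0<..} x *\<^sub>R g x) \<in> borel_measurable lebesgue"
  proof (rule borel_measurable_LIMSEQ_real)
    show "(\<lambda>x. indicator {1 / real (Suc n)<..real n} x *\<^sub>R g x) \<in> borel_measurable lebesgue" for n
      using weak_derivative_set_integrable[OF g, of "1 / real (Suc n)" "real n"]
      unfolding set_integrable_def by (intro borel_measurable_integrable) simp
    fix x :: real
    have "\<forall>\<^sub>F n in sequentially. indicator {1 / real (Suc n)<..real n} x *\<^sub>R g x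
        = indicator {0<..} x *\<^sub>R g x"
    proof (cases "0 < x")
      case True
      obtain m where m: "max x (1 / x) < real m" using reals_Archimedean2 by blast
      show ?thesis
        using eventually_ge_at_top[of m]
      proof eventually_elim
        case (elim n)
        then have "1 / x < real (Suc n)" "x \<le> real n" using m by auto
        then have "1 / real (Suc n) < x" using True by (simp add: field_simps del: of_nat_Suc)
        then show ?case using \<open>x \<le> real n\<close> True by simp
      qed
    next
      case False
      have "\<not> 1 / real (Suc n) < x" for n
      proof -
        have "0 < 1 / real (Suc n)" by simp
        then show ?thesis using False by linarith
      qed
      then show ?thesis using False by simp
    qed
    then show "(\<lambda>n. indicator {1 / real (Suc n)<..real n} x *\<^sub>R g x)
        \<longlonglongrightarrow> indicator {0<..} x *\<^sub>R g x"
      by (rule tendsto_eventually)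
  qed
  have ae: "AE x in lebesgue. indicator {0<..} x *\<^sub>R g' x = indicator {0<..} x *\<^sub>R g x"
    using weak_derivative_unique[OF f(1) g'(2) g] by eventually_elim (auto simp: indicator_def)
  show ?thesis
    unfolding set_integrable_def
    by (rule integrable_cong_AE_imp[OF g'(1)[unfolded set_integrable_def] meas ae])
qed

section \<open>Increments from level 0 and up to infinity\<close>

lemma set_integral_tendsto_pointwise:
  fixes g :: "real \<Rightarrow> real"
  assumes g: "set_integrable M B g"
    and A: "\<And>n. A n \<in> sets M" "\<And>n. A n \<subseteq> B"
    and C: "C \<in> sets M" "C \<subseteq> B"
    and lim: "\<And>x. x \<in> B \<Longrightarrow> \<forall>\<^sub>F n in sequentially. x \<in> A n \<longleftrightarrow> x \<in> C"
  shows "(\<lambda>n. LINT x:A n|M. g x) \<longlonglongrightarrow> (LINT x:C|M. g x)"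
  unfolding set_lebesgue_integral_def
proof (rule integral_dominated_convergence[where w="\<lambda>x. norm (indicator B x *\<^sub>R g x)"])
  show "AE x in M. (\<lambda>n. indicat_real (A n) x *\<^sub>R g x) \<longlonglongrightarrow> indicat_real C x *\<^sub>R g x"
  proof (rule AE_I2)
    fix x
    show "(\<lambda>n. indicat_real (A n) x *\<^sub>R g x) \<longlonglongrightarrow> indicat_real C x *\<^sub>R g x"
    proof (cases "x \<in> B")
      case True
      have "\<forall>\<^sub>F n in sequentially. indicat_real (A n) x *\<^sub>R g x = indicat_real C x *\<^sub>R g x"
        using lim[OF True] by eventually_elim (simp add: indicator_def)
      then show ?thesis by (rule tendsto_eventually)
    next
      case False
      then have "x \<notin> A n" "x \<notin> C" for n using A C by auto
      then show ?thesis by simp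
    qed
  qed
  show "AE x in M. norm (indicat_real (A n) x *\<^sub>R g x) \<le> norm (indicat_real B x *\<^sub>R g x)" for n
    using A(2)[of n] by (auto simp: indicator_def)
  show "(\<lambda>x. indicat_real (A n) x *\<^sub>R g x) \<in> borel_measurable M" for n
    using set_integrable_subset[OF g A] by (simp add: set_integrable_def)
  show "(\<lambda>x. indicat_real C x *\<^sub>R g x) \<in> borel_measurable M"
    using set_integrable_subset[OF g C] by (simp add: set_integrable_def)
  show "integrable M (\<lambda>x. norm (indicat_real B x *\<^sub>R g x))"
    using g unfolding set_integrable_def by (rule integrable_norm)
qed

text \<open>Test functions vanish near 0, so the end point 0 is reached only as a limit of
  \<open>b / (n + 1)\<close>: continuity of \<open>f\<close> at 0 handles one side, integrability of
  \<open>g\<close> up to 0 the other.\<close>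

lemma sobolev_increment:
  assumes f: "continuous_on {0..} f" "f \<in> sobolev_W11 {0<..}"
    and g: "has_weak_derivative_on f g {0<..}"
    and ab: "0 \<le> a" "a \<le> b"
  shows "f b - f a = (LINT x:{a<..b}|lebesgue. g x)"
proof (cases "a = 0")
  case False
  have "continuous_on {0<..} f" by (rule continuous_on_subset[OF f(1)]) auto
  then show ?thesis
    using weak_derivative_increment[OF _ g _ ab(2)] ab False by simp
next
  case True
  show ?thesis
  proof (cases "b = 0")
    case False
    have f': "continuous_on {0<..} f" by (rule continuous_on_subset[OF f(1)]) auto
    note g_int = sobolev_weak_derivative_integrable[OF f' f(2) g]
    have "(\<lambda>n. LINT x:{b / real (Suc n)<..b}|lebesgue. g x) \<longlonglongrightarrow> (LINT x:{0<..b}|lebesgue. g x)"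
    proof (rule set_integral_tendsto_pointwise[OF g_int])
      fix x :: real assume x: "x \<in> {0<..}"
      obtain m where m: "b / x < real m" using reals_Archimedean2 by blast
      show "\<forall>\<^sub>F n in sequentially. x \<in> {b / real (Suc n)<..b} \<longleftrightarrow> x \<in> {0<..b}"
        using eventually_ge_at_top[of m]
      proof eventually_elim
        case (elim n)
        then have "b / x < real (Suc n)" using m by simp
        then have "b / real (Suc n) < x" using x by (simp add: field_simps del: of_nat_Suc)
        then show ?case using x by simp
      qed
    next
      show "{b / real (Suc n)<..b} \<subseteq> {0<..}" for n
      proof -
        have "0 \<le> b / real (Suc n)" using ab True by simp
        then show ?thesis by (auto simp del: of_nat_Suc)
      qed
    qed auto
    moreover have "(LINT x:{b / real (Suc n)<..b}|lebesgue. g x) = f b - f (b / real (Suc n))" for n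
    proof (rule weak_derivative_increment[OF f' g, symmetric])
      show "0 < b / real (Suc n)" using ab True False by simp
      have "b / real (Suc n) \<le> b / 1"
        by (rule divide_left_mono) (use ab True in auto)
      then show "b / real (Suc n) \<le> b" by simp
    qed
    moreover have "(\<lambda>n. f b - f (b / real (Suc n))) \<longlonglongrightarrow> f b - f 0"
    proof -
      have "(\<lambda>n. b * inverse (real (Suc n))) \<longlonglongrightarrow> b * 0"
        by (intro tendsto_intros LIMSEQ_inverse_real_of_nat)
      then have "(\<lambda>n. b / real (Suc n)) \<longlonglongrightarrow> 0" by (simp add: divide_inverse)
      then have "(\<lambda>n. f (b / real (Suc n))) \<longlonglongrightarrow> f 0"
        by (rule continuous_on_tendsto_compose[OF f(1)]) (use ab True in auto)
      then show ?thesis by (intro tendsto_intros)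
    qed
    ultimately show ?thesis using True LIMSEQ_unique by auto
  qed (use True in \<open>simp add: set_lebesgue_integral_def\<close>)
qed

lemma sobolev_total_increment:
  assumes f: "continuous_on {0..} f" "f \<in> sobolev_W11 {0<..}"
    and g: "has_weak_derivative_on f g {0<..}"
    and lim: "(f \<longlongrightarrow> c) at_top"
  shows "c - f 0 = (LINT x:{0<..}|lebesgue. g x)"
proof -
  have f': "continuous_on {0<..} f" by (rule continuous_on_subset[OF f(1)]) auto
  note g_int = sobolev_weak_derivative_integrable[OF f' f(2) g]
  have "(\<lambda>n. LINT x:{0<..real n}|lebesgue. g x) \<longlonglongrightarrow> (LINT x:{0<..}|lebesgue. g x)"
  proof (rule set_integral_tendsto_pointwise[OF g_int])
    fix x :: real assume x: "x \<in> {0<..}"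
    obtain m where m: "x < real m" using reals_Archimedean2 by blast
    show "\<forall>\<^sub>F n in sequentially. x \<in> {0<..real n} \<longleftrightarrow> x \<in> {0<..}"
      using eventually_ge_at_top[of m] by eventually_elim (use m in auto)
  qed auto
  moreover have "(LINT x:{0<..real n}|lebesgue. g x) = f (real n) - f 0" for n
    using sobolev_increment[OF f g, of 0 "real n"] by simp
  moreover have "(\<lambda>n. f (real n) - f 0) \<longlonglongrightarrow> c - f 0"
    by (intro tendsto_intros filterlim_compose[OF lim filterlim_real_sequentially])
  ultimately show ?thesis using LIMSEQ_unique by auto
qed

section \<open>Weighted integrals along a path\<close>

text \<open>A sum over grid values only, so that it is jointly measurable in the end point \<open>x\<close> and the
  path \<open>q\<close> for the product sigma-algebra, in which evaluation at a random time is not measurable.\<close>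

definition stieltjes_sum :: "(real \<Rightarrow> real) \<Rightarrow> nat \<Rightarrow> real \<Rightarrow> (real \<Rightarrow> real) \<Rightarrow> real" where
  "stieltjes_sum w n x q = (\<Sum>i<n\<^sup>2. if real (Suc i) / real n \<le> x
     then w (real i / real n) * (q (real (Suc i) / real n) - q (real i / real n)) else 0)"

lemma measurable_stieltjes_sum:
  "(\<lambda>(x, q). stieltjes_sum w n x q) \<in> borel_measurable (borel \<Otimes>\<^sub>M (\<Pi>\<^sub>M l\<in>{0..}. borel))"
proof -
  have [measurable]: "(\<lambda>z. snd z t) \<in> borel_measurable (borel \<Otimes>\<^sub>M (\<Pi>\<^sub>M l\<in>{0..}. borel))"
    if "t \<ge> 0" for t :: real
    using that by (intro measurable_compose[OF measurable_snd measurable_component_singleton]) auto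
  show ?thesis
    unfolding stieltjes_sum_def split_beta'
    by (intro borel_measurable_sum measurable_If borel_measurable_times borel_measurable_diff
        borel_measurable_const) measurable
qed

text \<open>Because increments of \<open>f\<close> are integrals of \<open>g\<close>, the sum is the
  integral of \<open>g\<close> against a step function that samples \<open>w\<close> at left end
  points. Only cells ending at or before \<open>x\<close> occur, so monotonicity bounds the step
  function by the constant \<open>w x\<close>.\<close>

lemma stieltjes_sum_tendsto:
  fixes w f g :: "real \<Rightarrow> real"
  assumes g: "set_integrable lebesgue {0<..} g"
    and increment: "\<And>a b. 0 \<le> a \<Longrightarrow> a \<le> b \<Longrightarrow> f b - f a = (LINT l:{a<..b}|lebesgue. g l)"
    and w: "mono w" "\<And>l. 0 \<le> w l" "\<And>l. (w \<longlongrightarrow> w l) (at_left l)"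
  shows "(\<lambda>n. stieltjes_sum w n x f) \<longlonglongrightarrow> (LINT l:{0<..x}|lebesgue. w l * g l)"
proof -
  define G where "G = (\<lambda>l. indicator {0<..} l * g l)"
  have G: "integrable lebesgue G"
    using g by (simp add: set_integrable_def G_def)
  \<comment> \<open>The \<open>n\<^sup>2\<close> cells of width \<open>1 / n\<close> cover
    \<open>{0<..n}\<close>, so the grid becomes finer and longer at the same time. For
    \<open>n = 0\<close> the sum is empty.\<close>
  define s where "s n l = (\<Sum>i<n\<^sup>2. if real (Suc i) / real n \<le> x
     then w (real i / real n) * indicator {real i / real n<..real (Suc i) / real n} l else 0)"
    for n l
  \<comment> \<open>\<open>j\<close> is the index of the cell containing \<open>l\<close>. Cells are
    closed on the right, hence the ceiling minus one; for \<open>l \<le> 0\<close> the truncation by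
    \<open>nat\<close> would give cell 0, which the conjunct \<open>0 < l\<close> excludes.\<close>
  have s_eq: "s n l = (if 0 < l \<and> j < n\<^sup>2 \<and> real (Suc j) / real n \<le> x then w (real j / real n) else 0)"
    if n: "0 < n" and j: "j = nat (\<lceil>real n * l\<rceil> - 1)" for n l j
  proof (cases "0 < l")
    case False
    have "indicator {real i / real n<..real (Suc i) / real n} l = (0::real)" for i
    proof -
      have "0 \<le> real i / real n" by simp
      then have "\<not> real i / real n < l" using False by linarith
      then show ?thesis by (simp add: indicator_def)
    qed
    then show ?thesis using False by (simp add: s_def del: of_nat_Suc cong: if_cong)
  next
    case True
    have "l \<in> {real i / real n<..real (Suc i) / real n} \<longleftrightarrow> i = j" for i
    proof -
      have "l \<in> {real i / real n<..real (Suc i) / real n} \<longleftrightarrow> \<lceil>real n * l\<rceil> = int i + 1"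
        unfolding ceiling_eq_iff using n by (auto simp: field_simps)
      moreover have "\<lceil>real n * l\<rceil> > 0" using True n by simp
      ultimately show ?thesis unfolding j by linarith
    qed
    then have "s n l = (\<Sum>i<n\<^sup>2. if i = j then (if real (Suc j) / real n \<le> x
        then w (real j / real n) else 0) else 0)"
      unfolding s_def by (intro sum.cong) (auto simp: indicator_def)
    then show ?thesis using True by simp
  qed
  have s_sum: "stieltjes_sum w n x f = (\<integral>l. s n l * G l \<partial>lebesgue)" for n
  proof -
    have term_int: "integrable lebesgue (\<lambda>l. (if real (Suc i) / real n \<le> x
        then w (real i / real n) * indicator {real i / real n<..real (Suc i) / real n} l else 0) * G l)"
      for i
    proof -
      have "integrable lebesgue
          (\<lambda>l. w (real i / real n) * (indicator {real i / real n<..real (Suc i) / real n} l *\<^sub>R G l))"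
        by (intro integrable_mult_right integrable_mult_indicator G) simp
      then show ?thesis
        by (cases "real (Suc i) / real n \<le> x") (auto simp: mult.assoc simp del: of_nat_Suc)
    qed
    have "(\<integral>l. s n l * G l \<partial>lebesgue) = (\<Sum>i<n\<^sup>2. \<integral>l. (if real (Suc i) / real n \<le> x
        then w (real i / real n) * indicator {real i / real n<..real (Suc i) / real n} l else 0) * G l
        \<partial>lebesgue)"
      unfolding s_def sum_distrib_right by (rule Bochner_Integration.integral_sum) (rule term_int)
    also have "\<dots> = stieltjes_sum w n x f"
      unfolding stieltjes_sum_def
    proof (rule sum.cong)
      fix i
      have nonneg: "0 \<le> real i / real n" by simp
      have "f (real (Suc i) / real n) - f (real i / real n)
          = (LINT l:{real i / real n<..real (Suc i) / real n}|lebesgue. g l)"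
        by (rule increment) (auto intro: divide_right_mono)
      also have "\<dots> = (\<integral>l. indicator {real i / real n<..real (Suc i) / real n} l * G l \<partial>lebesgue)"
        unfolding set_lebesgue_integral_def
      proof (rule Bochner_Integration.integral_cong)
        fix l
        have "0 < l" if "real i / real n < l" using that nonneg by linarith
        then show "indicator {real i / real n<..real (Suc i) / real n} l *\<^sub>R g l
            = indicator {real i / real n<..real (Suc i) / real n} l * G l"
          by (simp add: indicator_def G_def del: of_nat_Suc)
      qed simp
      finally show "(\<integral>l. (if real (Suc i) / real n \<le> x
        then w (real i / real n) * indicator {real i / real n<..real (Suc i) / real n} l else 0) * G l
        \<partial>lebesgue) = (if real (Suc i) / real n \<le> x
        then w (real i / real n) * (f (real (Suc i) / real n) - f (real i / real n)) else 0)"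
        by (simp add: mult.assoc)
    qed simp
    finally show ?thesis by simp
  qed
  \<comment> \<open>At \<open>l = x\<close> the cell counts only if \<open>x\<close> is a grid
    point, so the values may oscillate with \<open>n\<close>; a single point is a null set.\<close>
  have s_lim: "(\<lambda>n. s n l) \<longlonglongrightarrow> indicator {0<..x} l * w l" if l: "l \<noteq> x" for l
  proof -
    consider "l \<le> 0" | "0 < l" "x < l" | "0 < l" "l < x" using l by linarith
    then show ?thesis
    proof cases
      case 1
      have "\<forall>\<^sub>F n in sequentially. s n l = 0"
        using eventually_gt_at_top[of "0::nat"]
        by eventually_elim (use 1 in \<open>simp add: s_eq[OF _ refl]\<close>)
      then show ?thesis using 1 by (simp add: tendsto_eventually)
    next
      case 2
      have "\<forall>\<^sub>F n in sequentially. s n l = 0"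
        using eventually_gt_at_top[of "0::nat"]
      proof eventually_elim
        case (elim n)
        define j where "j = nat (\<lceil>real n * l\<rceil> - 1)"
        have "\<lceil>real n * l\<rceil> > 0" using 2 elim by simp
        then have "real (Suc j) = of_int \<lceil>real n * l\<rceil>" by (simp add: j_def)
        then have "real n * l \<le> real (Suc j)" by simp
        then have "l \<le> real (Suc j) / real n"
          using elim by (simp add: field_simps del: of_nat_Suc)
        then show ?case using 2 by (simp add: s_eq[OF elim j_def] del: of_nat_Suc)
      qed
      then show ?thesis using 2 by (simp add: tendsto_eventually)
    next
      case 3
      \<comment> \<open>The left end points of the cells around \<open>l\<close> tend to
        \<open>l\<close> strictly from below, so the left limit of \<open>w\<close> is what is
        needed.\<close>
      define j where "j n = nat (\<lceil>real n * l\<rceil> - 1)" for n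
      have j: "real (j n) < real n * l" "real n * l \<le> real (j n) + 1" if "0 < n" for n
      proof -
        have "\<lceil>real n * l\<rceil> > 0" using 3 that by simp
        then have *: "real (j n) = of_int \<lceil>real n * l\<rceil> - 1" by (simp add: j_def)
        show "real (j n) < real n * l" "real n * l \<le> real (j n) + 1"
          unfolding * using ceiling_correct[of "real n * l"] by auto
      qed
      have below: "real (j n) / real n < l" "l - 1 / real n \<le> real (j n) / real n" if "0 < n" for n
      proof -
        show "real (j n) / real n < l"
          using j(1)[OF that] that by (simp add: field_simps)
        have "l \<le> (real (j n) + 1) / real n"
          using j(2)[OF that] that by (simp add: pos_le_divide_eq mult.commute)
        then show "l - 1 / real n \<le> real (j n) / real n"
          by (simp add: add_divide_distrib)
      qed
      have inv0: "(\<lambda>n. 1 / real n) \<longlonglongrightarrow> 0"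
        by (rule lim_1_over_n)
      have "(\<lambda>n. real (j n) / real n) \<longlonglongrightarrow> l"
      proof (rule tendsto_sandwich)
        show "\<forall>\<^sub>F n in sequentially. l - 1 / real n \<le> real (j n) / real n"
          "\<forall>\<^sub>F n in sequentially. real (j n) / real n \<le> l"
          using eventually_gt_at_top[of "0::nat"]
          by (eventually_elim, use below in \<open>auto intro: less_imp_le\<close>)+
        show "(\<lambda>n. l - 1 / real n) \<longlonglongrightarrow> l"
          using tendsto_diff[OF tendsto_const inv0, of l] by simp
      qed simp
      moreover have "\<forall>\<^sub>F n in sequentially. real (j n) / real n < l"
        using eventually_gt_at_top[of "0::nat"] by eventually_elim (rule below)
      ultimately have "filterlim (\<lambda>n. real (j n) / real n) (at_left l) sequentially"
        by (rule tendsto_imp_filterlim_at_left)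
      with w(3) have "(\<lambda>n. w (real (j n) / real n)) \<longlonglongrightarrow> w l"
        by (rule filterlim_compose)
      moreover have "\<forall>\<^sub>F n in sequentially. w (real (j n) / real n) = s n l"
      proof -
        \<comment> \<open>\<open>n \<ge> m\<close> makes the grid reach beyond \<open>l\<close>, and
          \<open>1 / n < x - l\<close> makes the cell around \<open>l\<close> end before
          \<open>x\<close>.\<close>
        obtain m where m: "x < real m" using reals_Archimedean2 by blast
        have "\<forall>\<^sub>F n in sequentially. 1 / real n < x - l"
          using order_tendstoD(2)[OF inv0] 3 by simp
        then show ?thesis
          using eventually_gt_at_top[of "0::nat"] eventually_ge_at_top[of m]
        proof eventually_elim
          case (elim n)
          have "real (j n) < real n * real n"
          proof -
            have "l \<le> real n" using 3 m elim by linarith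
            then have "real n * l \<le> real n * real n" by (intro mult_left_mono) auto
            with j(1)[of n] elim show ?thesis by linarith
          qed
          then have "j n < n\<^sup>2"
            unfolding power2_eq_square by (metis of_nat_less_iff of_nat_mult)
          moreover have "real (Suc (j n)) / real n \<le> x"
          proof -
            have "real (Suc (j n)) / real n = real (j n) / real n + 1 / real n"
              by (simp add: add_divide_distrib)
            then show ?thesis using below(1)[of n] elim by linarith
          qed
          ultimately show ?case
            using 3 elim by (simp add: s_eq[OF _ j_def] del: of_nat_Suc)
        qed
      qed
      ultimately show ?thesis
        using 3 by (simp add: Lim_transform_eventually)
    qed
  qed
  have s_bound: "\<bar>s n l\<bar> \<le> w x" for n l
  proof (cases "n = 0")
    case True
    then show ?thesis using w(2)[of x] by (simp add: s_def)
  next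
    case False
    define j where "j = nat (\<lceil>real n * l\<rceil> - 1)"
    have "w (real j / real n) \<le> w x" if "real (Suc j) / real n \<le> x"
    proof -
      have "real j / real n \<le> real (Suc j) / real n" by (intro divide_right_mono) auto
      then show ?thesis using that by (intro monoD[OF w(1)]) linarith
    qed
    moreover have "s n l = (if 0 < l \<and> j < n\<^sup>2 \<and> real (Suc j) / real n \<le> x
        then w (real j / real n) else 0)"
      using False by (intro s_eq j_def) simp
    ultimately show ?thesis
      using w(2)[of x] w(2)[of "real j / real n"] by auto
  qed
  have w_meas: "w \<in> borel_measurable lebesgue"
    using borel_measurable_mono[OF w(1)] by (intro measurable_completion) simp
  have G_meas: "G \<in> borel_measurable lebesgue" using G by simp
  have ind_meas: "indicat_real {a<..b} \<in> borel_measurable lebesgue" for a b :: real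
    by (intro borel_measurable_indicator) simp
  have "(\<lambda>n. \<integral>l. s n l * G l \<partial>lebesgue) \<longlonglongrightarrow> (\<integral>l. indicator {0<..x} l * w l * G l \<partial>lebesgue)"
  proof (rule integral_dominated_convergence[where w="\<lambda>l. w x * \<bar>G l\<bar>"])
    show "(\<lambda>l. indicator {0<..x} l * w l * G l) \<in> borel_measurable lebesgue"
      by (intro borel_measurable_times w_meas G_meas ind_meas)
    have "(\<lambda>l. s n l) \<in> borel_measurable lebesgue" for n
      unfolding s_def using ind_meas
      by (intro borel_measurable_sum) (simp add: borel_measurable_times del: of_nat_Suc)
    then show "(\<lambda>l. s n l * G l) \<in> borel_measurable lebesgue" for n
      by (intro borel_measurable_times G_meas)
    show "integrable lebesgue (\<lambda>l. w x * \<bar>G l\<bar>)"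
      using G by simp
    have "AE l in lebesgue. l \<noteq> x"
      by (rule AE_completion[OF AE_lborel_singleton])
    then show "AE l in lebesgue. (\<lambda>n. s n l * G l) \<longlonglongrightarrow> indicator {0<..x} l * w l * G l"
      by eventually_elim (intro tendsto_intros s_lim)
    show "AE l in lebesgue. norm (s n l * G l) \<le> w x * \<bar>G l\<bar>" for n
      using s_bound by (auto simp: abs_mult mult_right_mono)
  qed
  moreover have "indicator {0<..x} l * w l * G l = indicator {0<..x} l *\<^sub>R (w l * g l)" for l
    by (auto simp: G_def indicator_def)
  ultimately show ?thesis
    unfolding s_sum set_lebesgue_integral_def by simp
qed

text \<open>The closed half-lines \<open>{S n..}\<close> shrink to \<open>{l..}\<close> when
  \<open>S n\<close> increases to \<open>l\<close>. This supplies the left limits of the weight that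
  the Stieltjes sums require.\<close>

lemma measure_atLeast_left_continuous:
  fixes M :: "real measure"
  assumes "finite_measure M" "sets M = sets borel"
  shows "((\<lambda>l. measure M {l..}) \<longlongrightarrow> measure M {l..}) (at_left l)"
proof (rule tendsto_at_left_sequentially[of "l - 1"])
  interpret finite_measure M by fact
  fix S :: "nat \<Rightarrow> real"
  assume S: "\<And>n. S n < l" "incseq S" "S \<longlonglongrightarrow> l"
  have "(\<lambda>n. measure M {S n..}) \<longlonglongrightarrow> measure M (\<Inter>n. {S n..})"
    using S(2) assms
    by (intro finite_Lim_measure_decseq) (auto simp: decseq_def incseq_def intro: order_trans)
  moreover have "(\<Inter>n. {S n..}) = {l..}"
  proof
    show "{l..} \<subseteq> (\<Inter>n. {S n..})" using S(1) by (auto intro: less_imp_le less_le_trans)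
    show "(\<Inter>n. {S n..}) \<subseteq> {l..}" using LIMSEQ_le_const2[OF S(3)] by auto
  qed
  ultimately show "(\<lambda>n. measure M {S n..}) \<longlonglongrightarrow> measure M {l..}" by simp
qed simp

text \<open>Since the weight is unbounded, integrability on the product is not visible in advance.
  Integrating absolute values over \<open>x\<close> first gives exactly the L1 norm of
  \<open>g\<close> on the half-line, and this finite value then licenses Fubini for the signed
  integrand.\<close>

lemma survival_weighted_integral:
  fixes \<nu> :: "real measure" and g :: "real \<Rightarrow> real"
  assumes "prob_space \<nu>" and sets: "sets \<nu> = sets borel"
    and pos: "\<And>l. measure \<nu> {l..} > 0"
    and g: "set_integrable lebesgue {0<..} g"
  defines "J x \<equiv> (LINT l:{0<..x}|lebesgue. 1 / measure \<nu> {l..} * g l)"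
  shows "(\<integral>\<^sup>+x. ennreal \<bar>J x\<bar> \<partial>\<nu>) \<le> (\<integral>\<^sup>+l\<in>{0<..}. ennreal \<bar>g l\<bar> \<partial>lebesgue)"
    and "(LINT x|\<nu>. J x) = (LINT l:{0<..}|lebesgue. g l)"
proof -
  interpret \<nu>: prob_space \<nu> by fact
  interpret pair_sigma_finite \<nu> lborel ..
  note [measurable_cong] = sets
  have space: "space \<nu> = UNIV" using sets_eq_imp_space_eq[OF sets] by simp
  define w where "w l = 1 / measure \<nu> {l..}" for l
  have w_pos: "0 < w l" for l using pos by (simp add: w_def)
  have w_cancel: "w l * measure \<nu> {l..} = 1" for l using pos[of l] by (simp add: w_def)
  have "mono w"
    unfolding w_def
    by (intro monoI divide_left_mono \<nu>.finite_measure_mono mult_pos_pos pos) (auto simp: sets)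
  then have w_meas[measurable]: "w \<in> borel_measurable borel" by (rule borel_measurable_mono)
  define G where "G = (\<lambda>l. indicator {0<..} l * g l)"
  have G: "integrable lebesgue G"
    using g by (simp add: set_integrable_def G_def)
  \<comment> \<open>The product with \<open>lborel\<close> needs a Borel integrand. The exceptional
    null set of \<open>v\<close> does not depend on \<open>x\<close>, so one choice serves all end
    points.\<close>
  obtain v where v[measurable]: "v \<in> borel_measurable lborel" and "AE l in lborel. G l = v l"
    using completion_ex_borel_measurable_real[OF borel_measurable_integrable[OF G]] by blast
  then have ae: "AE l in lebesgue. G l = v l" by (intro AE_completion)
  have v': "v \<in> borel_measurable lebesgue" using v by (intro measurable_completion) simp
  have "integrable lebesgue v"
    using integrable_cong_AE[OF borel_measurable_integrable[OF G] v' ae] G by simp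
  then have v_int: "integrable lborel v"
    using integrable_completion[OF v] by simp
  define F where "F = (\<lambda>(x, l). indicator {0<..x} l * (w l * v l))"
  have F[measurable]: "F \<in> borel_measurable (\<nu> \<Otimes>\<^sub>M lborel)"
  proof -
    have "F = (\<lambda>z. (if 0 < snd z \<and> snd z \<le> fst z then 1 else 0) * (w (snd z) * v (snd z)))"
      by (auto simp: F_def indicator_def)
    then show ?thesis by simp
  qed
  have J_F: "J x = (\<integral>l. F (x, l) \<partial>lborel)" for x
  proof -
    have "J x = (\<integral>l. indicator {0<..x} l * (w l * G l) \<partial>lebesgue)"
      unfolding J_def set_lebesgue_integral_def w_def
      by (rule Bochner_Integration.integral_cong) (auto simp: G_def indicator_def)
    also have "\<dots> = (\<integral>l. F (x, l) \<partial>lebesgue)"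
    proof (rule integral_cong_AE)
      have "w \<in> borel_measurable lebesgue" "indicat_real {0<..x} \<in> borel_measurable lebesgue"
        by (intro measurable_completion; simp)+
      then show "(\<lambda>l. indicator {0<..x} l * (w l * G l)) \<in> borel_measurable lebesgue"
        "(\<lambda>l. F (x, l)) \<in> borel_measurable lebesgue"
        using v' G by (auto simp: F_def)
      show "AE l in lebesgue. indicator {0<..x} l * (w l * G l) = F (x, l)"
        using ae by eventually_elim (simp add: F_def)
    qed
    also have "\<dots> = (\<integral>l. F (x, l) \<partial>lborel)"
      by (rule integral_completion) (simp add: F_def)
    finally show ?thesis .
  qed
  have G_v_nn: "(\<integral>\<^sup>+l. ennreal \<bar>indicator {0<..} l * v l\<bar> \<partial>lborel)
      = (\<integral>\<^sup>+l\<in>{0<..}. ennreal \<bar>g l\<bar> \<partial>lebesgue)"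
  proof -
    have "(\<integral>\<^sup>+l. ennreal \<bar>indicator {0<..} l * v l\<bar> \<partial>lborel)
        = (\<integral>\<^sup>+l. ennreal \<bar>indicator {0<..} l * v l\<bar> \<partial>lebesgue)"
      by (rule nn_integral_completion[symmetric])
    also have "\<dots> = (\<integral>\<^sup>+l\<in>{0<..}. ennreal \<bar>g l\<bar> \<partial>lebesgue)"
    proof (rule nn_integral_cong_AE)
      show "AE l in lebesgue. ennreal \<bar>indicator {0<..} l * v l\<bar>
          = ennreal \<bar>g l\<bar> * indicator {0<..} l"
        using ae
      proof eventually_elim
        case (elim l)
        then show ?case by (cases "0 < l") (auto simp: G_def)
      qed
    qed
    finally show ?thesis .
  qed
  have inner: "(\<integral>\<^sup>+x. ennreal \<bar>F (x, l)\<bar> \<partial>\<nu>) = ennreal \<bar>indicator {0<..} l * v l\<bar>" for l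
  proof -
    have "ennreal \<bar>F (x, l)\<bar> = ennreal (indicator {0<..} l * w l * \<bar>v l\<bar>) * indicator {l..} x" for x
      using w_pos[of l] by (auto simp: F_def indicator_def abs_mult)
    then have "(\<integral>\<^sup>+x. ennreal \<bar>F (x, l)\<bar> \<partial>\<nu>)
        = ennreal (indicator {0<..} l * w l * \<bar>v l\<bar>) * emeasure \<nu> {l..}"
      by (simp add: nn_integral_cmult_indicator sets)
    also have "\<dots> = ennreal (indicator {0<..} l * \<bar>v l\<bar> * (w l * measure \<nu> {l..}))"
      using w_pos[of l] by (simp add: \<nu>.emeasure_eq_measure flip: ennreal_mult)
    also have "\<dots> = ennreal \<bar>indicator {0<..} l * v l\<bar>"
      unfolding w_cancel by (simp add: abs_mult)
    finally show ?thesis .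
  qed
  have nn: "(\<integral>\<^sup>+x. (\<integral>\<^sup>+l. ennreal \<bar>F (x, l)\<bar> \<partial>lborel) \<partial>\<nu>) = (\<integral>\<^sup>+l\<in>{0<..}. ennreal \<bar>g l\<bar> \<partial>lebesgue)"
    using Fubini[of "\<lambda>z. ennreal \<bar>F z\<bar>"] unfolding inner G_v_nn by simp
  have "(\<integral>\<^sup>+x. ennreal \<bar>J x\<bar> \<partial>\<nu>) \<le> (\<integral>\<^sup>+x. (\<integral>\<^sup>+l. ennreal \<bar>F (x, l)\<bar> \<partial>lborel) \<partial>\<nu>)"
  proof (rule nn_integral_mono)
    fix x
    show "ennreal \<bar>J x\<bar> \<le> (\<integral>\<^sup>+l. ennreal \<bar>F (x, l)\<bar> \<partial>lborel)"
    \<comment> \<open>A section that is not integrable has Bochner integral 0 by convention, and the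
      bound is then trivial.\<close>
    proof (cases "integrable lborel (\<lambda>l. F (x, l))")
      case True
      then show ?thesis
        using integral_norm_bound_ennreal[OF True] by (simp add: J_F)
    qed (simp add: J_F not_integrable_integral_eq)
  qed
  then show "(\<integral>\<^sup>+x. ennreal \<bar>J x\<bar> \<partial>\<nu>) \<le> (\<integral>\<^sup>+l\<in>{0<..}. ennreal \<bar>g l\<bar> \<partial>lebesgue)"
    unfolding nn .
  have "(\<integral>\<^sup>+l. ennreal \<bar>indicator {0<..} l * v l\<bar> \<partial>lborel) < \<infinity>"
  proof -
    have "integrable lborel (\<lambda>l. indicator {0<..} l *\<^sub>R v l)"
      by (rule integrable_mult_indicator[OF _ v_int]) simp
    then show ?thesis by (simp add: integrable_iff_bounded)
  qed
  then have "(\<integral>\<^sup>+z. ennreal (norm (F z)) \<partial>(\<nu> \<Otimes>\<^sub>M lborel)) < \<infinity>"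
    using nn lborel.nn_integral_fst[of "\<lambda>z. ennreal \<bar>F z\<bar>" \<nu>] unfolding G_v_nn by simp
  then have F_int: "integrable (\<nu> \<Otimes>\<^sub>M lborel) F"
    using F by (simp add: integrable_iff_bounded)
  have "(LINT x|\<nu>. J x) = (\<integral>l. (\<integral>x. F (x, l) \<partial>\<nu>) \<partial>lborel)"
    unfolding J_F using F_int by (intro Fubini_integral[symmetric]) simp
  also have "\<dots> = (\<integral>l. indicator {0<..} l * v l \<partial>lborel)"
  proof (rule Bochner_Integration.integral_cong)
    fix l :: real
    have "F (x, l) = indicator {l..} x * (indicator {0<..} l * (w l * v l))" for x
      by (auto simp: F_def indicator_def)
    then have "(\<integral>x. F (x, l) \<partial>\<nu>) = measure \<nu> {l..} * (indicator {0<..} l * (w l * v l))"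
      by (simp add: space)
    also have "\<dots> = (w l * measure \<nu> {l..}) * (indicator {0<..} l * v l)"
      by (simp add: ac_simps)
    finally show "(\<integral>x. F (x, l) \<partial>\<nu>) = indicator {0<..} l * v l"
      unfolding w_cancel by simp
  qed simp
  also have "\<dots> = (\<integral>l. indicator {0<..} l * v l \<partial>lebesgue)"
    by (rule integral_completion[symmetric]) simp
  also have "\<dots> = (LINT l:{0<..}|lebesgue. g l)"
    unfolding set_lebesgue_integral_def
  proof (rule integral_cong_AE)
    have "indicat_real {0::real<..} \<in> borel_measurable lebesgue"
      by (intro borel_measurable_indicator sets_completionI_sets) simp
    then show "(\<lambda>l. indicator {0<..} l * v l) \<in> borel_measurable lebesgue"
      using v' by auto
    show "(\<lambda>l. indicator {0<..} l *\<^sub>R g l) \<in> borel_measurable lebesgue"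
      using G by (simp add: G_def)
    show "AE l in lebesgue. indicator {0<..} l * v l = indicator {0<..} l *\<^sub>R g l"
      using ae by eventually_elim (auto simp: G_def indicator_def)
  qed
  finally show "(LINT x|\<nu>. J x) = (LINT l:{0<..}|lebesgue. g l)" .
qed

section \<open>Independence and the estimator\<close>

text \<open>Independence prevents the summands from cancelling: under the product law almost every
  section, with \<open>x\<close> fixed, is integrable in \<open>y\<close>, and one such section
  suffices because it differs from \<open>y\<close> by a constant.\<close>

lemma (in prob_space) integrable_indep_summand:
  fixes X Y :: "'a \<Rightarrow> real"
  assumes indep: "indep_var borel X borel Y" and int: "integrable M (\<lambda>\<omega>. X \<omega> + Y \<omega>)"
  shows "integrable M Y"
proof -
  have X[measurable]: "X \<in> borel_measurable M" and Y[measurable]: "Y \<in> borel_measurable M"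
    using indep_var_rv1[OF indep] indep_var_rv2[OF indep] by simp_all
  interpret X: prob_space "distr M borel X" by (rule prob_space_distr) fact
  interpret Y: prob_space "distr M borel Y" by (rule prob_space_distr) fact
  interpret pair_sigma_finite "distr M borel X" "distr M borel Y" ..
  have "distr M borel X \<Otimes>\<^sub>M distr M borel Y = distr M (borel \<Otimes>\<^sub>M borel) (\<lambda>\<omega>. (X \<omega>, Y \<omega>))"
    using indep unfolding indep_var_distribution_eq by blast
  moreover have "integrable (distr M (borel \<Otimes>\<^sub>M borel) (\<lambda>\<omega>. (X \<omega>, Y \<omega>))) (\<lambda>z. fst z + snd z)"
    using int by (subst integrable_distr_eq) simp_all
  ultimately have "integrable (distr M borel X \<Otimes>\<^sub>M distr M borel Y) (\<lambda>z. fst z + snd z)"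
    by simp
  from AE_integrable_fst'[OF this]
  obtain x where "integrable (distr M borel Y) (\<lambda>y. x + y)"
    using eventually_happens'[OF X.ae_filter_bot] by fastforce
  then have "integrable (distr M borel Y) (\<lambda>y. (x + y) - x)"
    by (intro Bochner_Integration.integrable_diff) simp_all
  then have "integrable (distr M borel Y) (\<lambda>y. y)" by simp
  then show ?thesis
    by (subst (asm) integrable_distr_eq) simp_all
qed

text \<open>One term is independent of the sum of the others, so that sum is integrable, and the
  term is a difference of integrable functions.\<close>

lemma (in prob_space) integrable_indep_summands:
  fixes X :: "'i \<Rightarrow> 'a \<Rightarrow> real"
  assumes "finite I" "indep_vars (\<lambda>_. borel) X I" "integrable M (\<lambda>\<omega>. \<Sum>i\<in>I. X i \<omega>)" "i \<in> I"
  shows "integrable M (X i)"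
proof -
  define I' where "I' = I - {i}"
  have I: "I = insert i I'" "finite I'" "i \<notin> I'" using assms by (auto simp: I'_def)
  have sum: "(\<lambda>\<omega>. \<Sum>i\<in>I. X i \<omega>) = (\<lambda>\<omega>. X i \<omega> + (\<Sum>i\<in>I'. X i \<omega>))"
    unfolding I(1) using I(2,3) by simp
  have rest: "integrable M (\<lambda>\<omega>. \<Sum>i\<in>I'. X i \<omega>)"
  proof (rule integrable_indep_summand)
    show "indep_var borel (X i) borel (\<lambda>\<omega>. \<Sum>i\<in>I'. X i \<omega>)"
      by (rule indep_vars_sum[OF I(2,3) assms(2)[unfolded I(1)]])
    show "integrable M (\<lambda>\<omega>. X i \<omega> + (\<Sum>i\<in>I'. X i \<omega>))"
      using assms(3) unfolding sum .
  qed
  have "integrable M (\<lambda>\<omega>. (X i \<omega> + (\<Sum>i\<in>I'. X i \<omega>)) - (\<Sum>i\<in>I'. X i \<omega>))"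
    using assms(3) unfolding sum by (rule Bochner_Integration.integrable_diff) (rule rest)
  then show ?thesis by simp
qed

text \<open>The second factor stays \<open>M\<close> instead of becoming the law of the path: the
  sample point remains available, and with it \<open>dQ\<close>, which need not be a function of the
  path.\<close>

lemma (in prob_space) indep_of_process_joint_distr:
  fixes L :: "'a \<Rightarrow> real" and Q :: "real \<Rightarrow> 'a \<Rightarrow> real"
  assumes indep: "indep_of_process M L Q"
    and L[measurable]: "L \<in> borel_measurable M"
    and Q: "\<And>l. l \<ge> 0 \<Longrightarrow> Q l \<in> borel_measurable M"
  defines "T \<equiv> (\<Pi>\<^sub>M l\<in>{0..}. borel)" and "X \<equiv> (\<lambda>\<omega>. \<lambda>l\<in>{0..}. Q l \<omega>)"
  shows "distr M (borel \<Otimes>\<^sub>M T) (\<lambda>\<omega>. (L \<omega>, X \<omega>))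
    = distr (distr M borel L \<Otimes>\<^sub>M M) (borel \<Otimes>\<^sub>M T) (\<lambda>(x, \<omega>). (x, X \<omega>))"
proof -
  have X[measurable]: "X \<in> measurable M T"
    unfolding X_def T_def by (rule measurable_restrict) (use Q in auto)
  interpret L: prob_space "distr M borel L" by (rule prob_space_distr) fact
  interpret X: prob_space "distr M T X" by (rule prob_space_distr) fact
  have "distr M borel L \<Otimes>\<^sub>M distr M T X = distr M (borel \<Otimes>\<^sub>M T) (\<lambda>\<omega>. (L \<omega>, X \<omega>))"
  proof (rule pair_measure_eqI)
    show "sigma_finite_measure (distr M borel L)" "sigma_finite_measure (distr M T X)" ..
    show "sets (distr M borel L \<Otimes>\<^sub>M distr M T X)
        = sets (distr M (borel \<Otimes>\<^sub>M T) (\<lambda>\<omega>. (L \<omega>, X \<omega>)))"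
      by (simp cong: sets_pair_measure_cong)
    fix A B assume AB: "A \<in> sets (distr M borel L)" "B \<in> sets (distr M T X)"
    then have [measurable]: "A \<in> sets borel" "B \<in> sets T" by simp_all
    have "prob ((L -` A \<inter> space M) \<inter> (X -` B \<inter> space M))
        = prob (L -` A \<inter> space M) * prob (X -` B \<inter> space M)"
      by (rule indep_setD[OF indep[unfolded indep_of_process_def]])
        (use AB in \<open>auto simp: X_def T_def\<close>)
    moreover have "(L -` A \<inter> space M) \<inter> (X -` B \<inter> space M)
        = (\<lambda>\<omega>. (L \<omega>, X \<omega>)) -` (A \<times> B) \<inter> space M" by auto
    ultimately show "emeasure (distr M borel L) A * emeasure (distr M T X) B
        = emeasure (distr M (borel \<Otimes>\<^sub>M T) (\<lambda>\<omega>. (L \<omega>, X \<omega>))) (A \<times> B)"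
      by (simp add: emeasure_distr emeasure_eq_measure ennreal_mult)
  qed
  moreover have "distr M borel L \<Otimes>\<^sub>M distr M T X
      = distr (distr M borel L \<Otimes>\<^sub>M M) (borel \<Otimes>\<^sub>M T) (\<lambda>(x, \<omega>). (x, X \<omega>))"
  proof -
    have "distr (distr M borel L) borel (\<lambda>x. x) = distr M borel L"
      by (rule distr_id2) simp
    then show ?thesis
      using pair_measure_distr[of "\<lambda>x. x" "distr M borel L" borel X M T]
        X.sigma_finite_measure_axioms by simp
  qed
  ultimately show ?thesis by simp
qed

theorem corollary2p2:
  fixes M :: "'a measure" and P :: "'b measure"
    and Q dQ :: "real \<Rightarrow> 'a \<Rightarrow> real" and Qinf L :: "'a \<Rightarrow> real"
    and N :: nat and S :: "nat \<Rightarrow> 'b \<Rightarrow> 'a"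
  assumes "prob_space M"
    and "\<And>l. l \<ge> 0 \<Longrightarrow> Q l \<in> borel_measurable M"
    and "Qinf \<in> borel_measurable M"
    and "AE \<omega> in M. ((\<lambda>l. Q l \<omega>) \<longlongrightarrow> Qinf \<omega>) at_top"
    \<comment> \<open>elements of the Sobolev space are identified with their continuous
        representatives, which gives \<open>Q 0\<close> its meaning as a boundary value\<close>
    and "AE \<omega> in M. (\<lambda>l. Q l \<omega>) \<in> sobolev_W11 {0<..} \<and> continuous_on {0..} (\<lambda>l. Q l \<omega>)"
    and "AE \<omega> in M. has_weak_derivative_on (\<lambda>l. Q l \<omega>) (\<lambda>l. dQ l \<omega>) {0<..}"
    and "integrable M L"
    and "AE \<omega> in M. L \<omega> \<ge> 0"
    and "indep_of_process M L Q"
    and "\<And>l. l \<ge> 0 \<Longrightarrow> measure M {\<omega> \<in> space M. L \<omega> \<ge> l} > 0"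
    and "N \<ge> 1"
    and "prob_space P"
    and "prob_space.indep_vars P (\<lambda>_. M) S {1..N}"
    and "\<And>k. k \<in> {1..N} \<Longrightarrow> distr P M (S k) = M"
    and "clmc_estimator M dQ L N S \<in> borel_measurable P"
  shows "((\<integral>\<^sup>+\<omega>. (\<integral>\<^sup>+l\<in>{0<..}. ennreal \<bar>dQ l \<omega>\<bar> \<partial>lebesgue) \<partial>M) < \<infinity> \<longrightarrow>
            integrable P (clmc_estimator M dQ L N S))
       \<and> (integrable P (clmc_estimator M dQ L N S) \<longrightarrow>
            integrable M (\<lambda>\<omega>. Qinf \<omega> - Q 0 \<omega>) \<and>
            (LINT \<eta>|P. clmc_estimator M dQ L N S \<eta>) = (LINT \<omega>|M. Qinf \<omega> - Q 0 \<omega>))"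
proof -
  interpret M: prob_space M by fact
  interpret P: prob_space P by fact
  have L[measurable]: "L \<in> borel_measurable M"
    using \<open>integrable M L\<close> by simp
  define \<nu> where "\<nu> = distr M borel L"
  have sets_\<nu>[measurable_cong]: "sets \<nu> = sets borel" by (simp add: \<nu>_def)
  have \<nu>: "prob_space \<nu>" unfolding \<nu>_def by (rule M.prob_space_distr) simp
  interpret \<nu>: prob_space \<nu> by (rule \<nu>)
  interpret pair_sigma_finite \<nu> M ..
  have \<nu>_tail: "measure \<nu> {l..} = measure M {\<omega> \<in> space M. L \<omega> \<ge> l}" for l
    unfolding \<nu>_def by (subst measure_distr) (auto intro!: arg_cong[where f="measure M"])
  \<comment> \<open>Below level 0 the tail is at least the tail at 0, so the weight is well defined
    and monotone on the whole line.\<close>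
  have \<nu>_pos: "measure \<nu> {l..} > 0" for l
  proof -
    have "0 < measure \<nu> {max 0 l..}"
      using assms(10)[of "max 0 l"] by (simp add: \<nu>_tail)
    also have "\<dots> \<le> measure \<nu> {l..}"
      by (rule \<nu>.finite_measure_mono) (auto simp: sets_\<nu>)
    finally show ?thesis .
  qed
  define w where "w l = 1 / measure \<nu> {l..}" for l
  have w: "mono w" "\<And>l. 0 \<le> w l" "\<And>l. (w \<longlongrightarrow> w l) (at_left l)"
  proof -
    show "mono w"
      unfolding w_def
      by (intro monoI divide_left_mono \<nu>.finite_measure_mono mult_pos_pos \<nu>_pos) (auto simp: sets_\<nu>)
    show "(w \<longlongrightarrow> w l) (at_left l)" for l
      unfolding w_def using \<nu>_pos[of l]
      by (intro tendsto_divide tendsto_const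
          measure_atLeast_left_continuous[OF \<nu>.finite_measure_axioms sets_\<nu>]) simp
  qed (simp add: w_def)

  define T :: "(real \<Rightarrow> real) measure" where "T = (\<Pi>\<^sub>M l\<in>{0..}. borel)"
  define X where "X = (\<lambda>\<omega>. \<lambda>l\<in>{0..}. Q l \<omega>)"
  have X[measurable]: "X \<in> measurable M T"
    unfolding X_def T_def by (rule measurable_restrict) (use assms(2) in auto)
  \<comment> \<open>\<open>lim\<close> is total and measurable even where the sums diverge, so
    \<open>Y\<close> and \<open>J\<close> are measurable everywhere although they equal the weighted
    integral only for almost every path.\<close>
  define H where "H = (\<lambda>(x, q). lim (\<lambda>n. stieltjes_sum w n x q))"
  have H[measurable]: "H \<in> borel_measurable (borel \<Otimes>\<^sub>M T)"
    using borel_measurable_lim_metric[OF measurable_stieltjes_sum[of w, folded T_def]]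
    by (simp add: H_def split_beta')
  define Y where "Y \<omega> = H (L \<omega>, X \<omega>)" for \<omega>
  define J where "J = (\<lambda>(x, \<omega>). H (x, X \<omega>))"
  have Y[measurable]: "Y \<in> borel_measurable M" unfolding Y_def by measurable
  have J[measurable]: "J \<in> borel_measurable (\<nu> \<Otimes>\<^sub>M M)" unfolding J_def by measurable
  \<comment> \<open>The level \<open>L \<omega>\<close> is replaced by an end point \<open>x\<close>
    drawn independently of the path, without changing the law.\<close>
  have distr_Y_J: "distr M borel Y = distr (\<nu> \<Otimes>\<^sub>M M) borel J"
  proof -
    have *: "(\<lambda>(x, \<omega>). (x, X \<omega>)) \<in> measurable (\<nu> \<Otimes>\<^sub>M M) (borel \<Otimes>\<^sub>M T)" by measurable
    have joint: "distr M (borel \<Otimes>\<^sub>M T) (\<lambda>\<omega>. (L \<omega>, X \<omega>))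
        = distr (\<nu> \<Otimes>\<^sub>M M) (borel \<Otimes>\<^sub>M T) (\<lambda>(x, \<omega>). (x, X \<omega>))"
      unfolding \<nu>_def T_def X_def
      by (rule M.indep_of_process_joint_distr[OF assms(9) L assms(2)])
    have "distr M borel Y = distr (distr M (borel \<Otimes>\<^sub>M T) (\<lambda>\<omega>. (L \<omega>, X \<omega>))) borel H"
      by (subst distr_distr) (auto simp: Y_def[abs_def] comp_def)
    also have "\<dots> = distr (\<nu> \<Otimes>\<^sub>M M) borel J"
      unfolding joint by (subst distr_distr[OF H *]) (simp add: J_def comp_def split_beta')
    finally show ?thesis .
  qed

  \<comment> \<open>The quantifier over \<open>x\<close> stands inside the almost-everywhere
    statement, so the random end point \<open>L \<omega>\<close> may be inserted for
    \<open>x\<close>.\<close>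
  have path: "AE \<omega> in M. (\<forall>x. H (x, X \<omega>) = (LINT l:{0<..x}|lebesgue. w l * dQ l \<omega>))
    \<and> set_integrable lebesgue {0<..} (\<lambda>l. dQ l \<omega>)
    \<and> Qinf \<omega> - Q 0 \<omega> = (LINT l:{0<..}|lebesgue. dQ l \<omega>)"
    using assms(4,5,6)
  proof eventually_elim
    case (elim \<omega>)
    then have cont: "continuous_on {0..} (\<lambda>l. Q l \<omega>)" and sob: "(\<lambda>l. Q l \<omega>) \<in> sobolev_W11 {0<..}"
      by auto
    have dQ: "set_integrable lebesgue {0<..} (\<lambda>l. dQ l \<omega>)"
      by (rule sobolev_weak_derivative_integrable[OF continuous_on_subset[OF cont] sob elim(3)]) auto
    have "H (x, X \<omega>) = (LINT l:{0<..x}|lebesgue. w l * dQ l \<omega>)" for x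
    proof -
      \<comment> \<open>All grid points are nonnegative, so the restriction of the path to
        \<open>{0..}\<close> is invisible to the sums.\<close>
      have "stieltjes_sum w n x (X \<omega>) = stieltjes_sum w n x (\<lambda>l. Q l \<omega>)" for n
        by (simp add: stieltjes_sum_def X_def cong: if_cong)
      then show ?thesis
        using stieltjes_sum_tendsto[OF dQ sobolev_increment[OF cont sob elim(3)] w]
        by (simp add: H_def limI)
    qed
    with dQ sobolev_total_increment[OF cont sob elim(3,1)] show ?case by simp
  qed

  define G where "G \<omega> = (LINT l:{0<..}|lebesgue.
      1 / measure M {\<omega> \<in> space M. L \<omega> \<ge> l} * dQ l \<omega> * indicator {0..L \<omega>} l)" for \<omega>
  have G_eq: "G \<omega> = (LINT l:{0<..L \<omega>}|lebesgue. w l * dQ l \<omega>)" for \<omega>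
    unfolding G_def set_lebesgue_integral_def
    by (rule Bochner_Integration.integral_cong) (auto simp: w_def \<nu>_tail indicator_def)
  have G_Y: "AE \<omega> in M. G \<omega> = Y \<omega>"
    using path by eventually_elim (simp add: G_eq Y_def)
  have S[measurable]: "S k \<in> measurable P M" if "k \<in> {1..N}" for k
    using assms(13) that unfolding P.indep_vars_def by auto
  have est: "AE \<eta> in P. clmc_estimator M dQ L N S \<eta> = (1 / real N) * (\<Sum>k=1..N. Y (S k \<eta>))"
  proof -
    have "AE \<eta> in P. \<forall>k\<in>{1..N}. G (S k \<eta>) = Y (S k \<eta>)"
    proof (rule AE_finite_allI)
      fix k assume k: "k \<in> {1..N}"
      show "AE \<eta> in P. G (S k \<eta>) = Y (S k \<eta>)"
        using G_Y by (intro AE_distrD[OF S[OF k], of "\<lambda>\<omega>. G \<omega> = Y \<omega>"])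
          (simp only: assms(14)[OF k])
    qed simp
    then show ?thesis
    proof eventually_elim
      case (elim \<eta>)
      have "clmc_estimator M dQ L N S \<eta> = (1 / real N) * (\<Sum>k=1..N. G (S k \<eta>))"
        unfolding clmc_estimator_def G_def ..
      with elim show ?case by simp
    qed
  qed
  have sum_meas: "(\<lambda>\<eta>. (1 / real N) * (\<Sum>k=1..N. Y (S k \<eta>))) \<in> borel_measurable P"
    by (intro borel_measurable_times borel_measurable_const borel_measurable_sum
        measurable_compose[OF S Y]) 
  have Y_S: "integrable P (\<lambda>\<eta>. Y (S k \<eta>)) \<longleftrightarrow> integrable M Y"
    "(LINT \<eta>|P. Y (S k \<eta>)) = (LINT \<omega>|M. Y \<omega>)" if k: "k \<in> {1..N}" for k
    using integrable_distr_eq[OF S[OF k] Y] integral_distr[OF S[OF k] Y]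
    unfolding assms(14)[OF k] by simp_all

  have est_int: "integrable P (clmc_estimator M dQ L N S) \<longleftrightarrow> integrable M Y"
  proof
    assume "integrable M Y"
    then have "integrable P (\<lambda>\<eta>. (1 / real N) * (\<Sum>k=1..N. Y (S k \<eta>)))"
      by (intro integrable_mult_right Bochner_Integration.integrable_sum) (simp add: Y_S)
    then show "integrable P (clmc_estimator M dQ L N S)"
      using integrable_cong_AE[OF assms(15) sum_meas est] by simp
  next
    assume "integrable P (clmc_estimator M dQ L N S)"
    then have "integrable P (\<lambda>\<eta>. (1 / real N) * (\<Sum>k=1..N. Y (S k \<eta>)))"
      using integrable_cong_AE[OF assms(15) sum_meas est] by simp
    then have "integrable P (\<lambda>\<eta>. real N * ((1 / real N) * (\<Sum>k=1..N. Y (S k \<eta>))))"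
      by (rule integrable_mult_right)
    then have "integrable P (\<lambda>\<eta>. \<Sum>k=1..N. Y (S k \<eta>))"
      using \<open>N \<ge> 1\<close> by simp
    \<comment> \<open>Independence of the samples transfers integrability from the mean to the first
      summand, whose law is that of \<open>Y\<close>.\<close>
    moreover have "P.indep_vars (\<lambda>_. borel) (\<lambda>k \<eta>. Y (S k \<eta>)) {1..N}"
      by (rule P.indep_vars_compose2[OF assms(13)]) simp
    ultimately have "integrable P (\<lambda>\<eta>. Y (S 1 \<eta>))"
      using P.integrable_indep_summands[of "{1..N}" "\<lambda>k \<eta>. Y (S k \<eta>)" 1] \<open>N \<ge> 1\<close> by simp
    then show "integrable M Y"
      using Y_S(1)[of 1] \<open>N \<ge> 1\<close> by simp
  qed
  have est_integral: "(LINT \<eta>|P. clmc_estimator M dQ L N S \<eta>) = (LINT \<omega>|M. Y \<omega>)"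
    if "integrable M Y"
  proof -
    have "(LINT \<eta>|P. clmc_estimator M dQ L N S \<eta>)
        = (LINT \<eta>|P. (1 / real N) * (\<Sum>k=1..N. Y (S k \<eta>)))"
      by (rule integral_cong_AE[OF assms(15) sum_meas est])
    also have "\<dots> = (1 / real N) * (\<Sum>k=1..N. LINT \<eta>|P. Y (S k \<eta>))"
      using that by (subst integral_mult_right_zero, subst Bochner_Integration.integral_sum)
        (simp_all add: Y_S)
    also have "\<dots> = (LINT \<omega>|M. Y \<omega>)"
      using \<open>N \<ge> 1\<close> by (simp add: Y_S)
    finally show ?thesis .
  qed

  have Y_J: "integrable M Y \<longleftrightarrow> integrable (\<nu> \<Otimes>\<^sub>M M) J" "(LINT \<omega>|M. Y \<omega>) = (LINT z|(\<nu> \<Otimes>\<^sub>M M). J z)"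
    "(\<integral>\<^sup>+\<omega>. ennreal \<bar>Y \<omega>\<bar> \<partial>M) = (\<integral>\<^sup>+z. ennreal \<bar>J z\<bar> \<partial>(\<nu> \<Otimes>\<^sub>M M))"
    using integrable_distr_eq[OF Y, of "\<lambda>x. x"] integrable_distr_eq[OF J, of "\<lambda>x. x"]
      integral_distr[OF Y, of "\<lambda>x. x"] integral_distr[OF J, of "\<lambda>x. x"]
      nn_integral_distr[OF Y, of "\<lambda>x. ennreal \<bar>x\<bar>"] nn_integral_distr[OF J, of "\<lambda>x. ennreal \<bar>x\<bar>"]
    unfolding distr_Y_J by simp_all
  have J_path: "AE \<omega> in M. (\<integral>\<^sup>+x. ennreal \<bar>J (x, \<omega>)\<bar> \<partial>\<nu>) \<le> (\<integral>\<^sup>+l\<in>{0<..}. ennreal \<bar>dQ l \<omega>\<bar> \<partial>lebesgue)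
    \<and> (LINT x|\<nu>. J (x, \<omega>)) = Qinf \<omega> - Q 0 \<omega>"
    using path
  proof eventually_elim
    case (elim \<omega>)
    then show ?case
      using survival_weighted_integral[OF \<nu> sets_\<nu> \<nu>_pos, of "\<lambda>l. dQ l \<omega>"]
      by (simp add: J_def w_def)
  qed
  show ?thesis
  proof (intro conjI impI)
    assume fin: "(\<integral>\<^sup>+\<omega>. (\<integral>\<^sup>+l\<in>{0<..}. ennreal \<bar>dQ l \<omega>\<bar> \<partial>lebesgue) \<partial>M) < \<infinity>"
    have "(\<integral>\<^sup>+\<omega>. ennreal \<bar>Y \<omega>\<bar> \<partial>M) = (\<integral>\<^sup>+\<omega>. (\<integral>\<^sup>+x. ennreal \<bar>J (x, \<omega>)\<bar> \<partial>\<nu>) \<partial>M)"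
      unfolding Y_J(3) by (rule nn_integral_snd[symmetric]) simp
    \<comment> \<open>The nonnegative integral is a supremum over simple functions below the
      integrand, hence monotone even though the L1 norm of the path derivative is not known to be
      measurable in \<open>\<omega>\<close>.\<close>
    also have "\<dots> \<le> (\<integral>\<^sup>+\<omega>. (\<integral>\<^sup>+l\<in>{0<..}. ennreal \<bar>dQ l \<omega>\<bar> \<partial>lebesgue) \<partial>M)"
      by (rule nn_integral_mono_AE) (use J_path in eventually_elim, simp)
    also note fin
    finally have "integrable M Y"
      by (simp add: integrable_iff_bounded)
    then show "integrable P (clmc_estimator M dQ L N S)"
      by (simp add: est_int)
  next
    assume "integrable P (clmc_estimator M dQ L N S)"
    then have Y_int: "integrable M Y" by (simp add: est_int)
    then have J_int: "integrable (\<nu> \<Otimes>\<^sub>M M) (\<lambda>(x, \<omega>). J (x, \<omega>))" by (simp add: Y_J)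
    have meas: "(\<lambda>\<omega>. Qinf \<omega> - Q 0 \<omega>) \<in> borel_measurable M"
      using assms(2)[of 0] assms(3) by simp
    have ae: "AE \<omega> in M. (LINT x|\<nu>. J (x, \<omega>)) = Qinf \<omega> - Q 0 \<omega>"
      using J_path by eventually_elim simp
    \<comment> \<open>Integrability of \<open>J\<close> alone makes its average over the end point
      integrable in \<open>\<omega>\<close>, and for almost every path this average is the total
      increment.\<close>
    have marginal: "integrable M (\<lambda>\<omega>. LINT x|\<nu>. J (x, \<omega>))"
      by (rule integrable_snd[OF J_int])
    show "integrable M (\<lambda>\<omega>. Qinf \<omega> - Q 0 \<omega>)"
      by (rule integrable_cong_AE_imp[OF marginal meas ae])
    have "(LINT \<eta>|P. clmc_estimator M dQ L N S \<eta>) = (LINT z|(\<nu> \<Otimes>\<^sub>M M). J z)"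
      using est_integral[OF Y_int] Y_J by simp
    also have "\<dots> = (LINT \<omega>|M. LINT x|\<nu>. J (x, \<omega>))"
      using integral_snd[OF J_int] by simp
    also have "\<dots> = (LINT \<omega>|M. Qinf \<omega> - Q 0 \<omega>)"
      by (rule integral_cong_AE[OF borel_measurable_integrable[OF marginal] meas ae])
    finally show "(LINT \<eta>|P. clmc_estimator M dQ L N S \<eta>) = (LINT \<omega>|M. Qinf \<omega> - Q 0 \<omega>)" .
  qed
qed

end
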